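(* Let $X$ and $Y$ be finite connected multigraphs with no vertices of degree one. If $Y/X$ is an abelian cover of multigraphs, then $\kappa_X \mid \kappa_Y$.
   Context: A multigraph $X$ consists of a set $V_X$ of vertices and a multiset $E_X$ of unordered pairs of vertices (edges); loops and multiple edges are allowed. The degree of a vertex is the number of edges incident to it, each loop counted twice. $\kappa_X$ is the number of spanning trees of $X$ (parallel edges being distinguished). Multigraphs are viewed as one-dimensional CW-complexes. A cover $Y/X$ of multigraphs is a topological covering map $\pi:Y\to X$ that is a morphism of multigraphs; $\mathrm{Aut}(Y/X)$ is its group of deck transformations. The cover is Galois if $\mathrm{Aut}(Y/X)$ acts transitively on each fiber, and abelian if moreover $\mathrm{Aut}(Y/X)$ is abelian. *)

theory Defs
  imports "HOL-Analysis.Analysis" "HOL-Algebra.Bij" "HOL-Library.Uprod"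
begin

section \<open>Multigraphs\<close>

text \<open>The multiset of edges is given as a set of labels, each carrying an unordered pair of
  end points; edges with equal ends but different labels are parallel. \<open>Upair v v\<close> is a loop.\<close>

record ('v, 'e) multigraph =
  verts :: "'v set"
  edges :: "'e set"
  ends :: "'e \<Rightarrow> 'v uprod"

definition multigraph :: "('v, 'e) multigraph \<Rightarrow> bool" where
  "multigraph X \<longleftrightarrow> (\<forall>e\<in>edges X. set_uprod (ends X e) \<subseteq> verts X)"

definition finite_multigraph :: "('v, 'e) multigraph \<Rightarrow> bool" where
  "finite_multigraph X \<longleftrightarrow> multigraph X \<and> finite (verts X) \<and> finite (edges X)"

definition vertex_degree :: "('v, 'e) multigraph \<Rightarrow> 'v \<Rightarrow> nat" where
  "vertex_degree X v =
     (\<Sum>e\<in>edges X. if ends X e = Upair v v then 2 else if v \<in> set_uprod (ends X e) then 1 else 0)"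

definition adjacent :: "('v, 'e) multigraph \<Rightarrow> 'v \<Rightarrow> 'v \<Rightarrow> bool" where
  "adjacent X u v \<longleftrightarrow> (\<exists>e\<in>edges X. ends X e = Upair u v)"

definition connected_multigraph :: "('v, 'e) multigraph \<Rightarrow> bool" where
  "connected_multigraph X \<longleftrightarrow>
     verts X \<noteq> {} \<and> (\<forall>u\<in>verts X. \<forall>v\<in>verts X. (adjacent X)\<^sup>*\<^sup>* u v)"

text \<open>The cycle runs through \<open>vs ! 0\<close>, \<open>es ! 0\<close>, \<open>vs ! 1\<close>, \<open>es ! 1\<close>, and so on, and back to
  \<open>vs ! 0\<close>. Length one is a loop, length two a pair of parallel edges.\<close>

definition is_cycle :: "('v, 'e) multigraph \<Rightarrow> 'v list \<Rightarrow> 'e list \<Rightarrow> bool" where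
  "is_cycle X vs es \<longleftrightarrow>
     es \<noteq> [] \<and> length vs = length es \<and> distinct vs \<and> distinct es \<and>
     set vs \<subseteq> verts X \<and> set es \<subseteq> edges X \<and>
     (\<forall>i<length es. ends X (es ! i) = Upair (vs ! i) (vs ! (Suc i mod length es)))"

definition is_tree :: "('v, 'e) multigraph \<Rightarrow> bool" where
  "is_tree X \<longleftrightarrow> connected_multigraph X \<and> (\<nexists>vs es. is_cycle X vs es)"

definition spanning_trees :: "('v, 'e) multigraph \<Rightarrow> 'e set set" where
  "spanning_trees X = {T. T \<subseteq> edges X \<and> is_tree (X\<lparr>edges := T\<rparr>)}"

definition num_spanning_trees :: "('v, 'e) multigraph \<Rightarrow> nat"  (\<open>\<kappa>\<close>) where
  "\<kappa> X = card (spanning_trees X)"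


section \<open>Geometric realization\<close>

text \<open>A point is a vertex, or the point with parameter \<open>t\<close> strictly between 0 and 1 on an edge.
  Parametrizing an edge requires an orientation, which is chosen arbitrarily; another choice
  replaces \<open>t\<close> by \<open>1 - t\<close> on some edges, which gives a homeomorphic space.\<close>

datatype ('v, 'e) point = Vertex 'v | Inner 'e real

definition orient :: "('v, 'e) multigraph \<Rightarrow> 'e \<Rightarrow> 'v \<times> 'v" where
  "orient X e = (SOME (a, b). ends X e = Upair a b)"

lemma ends_orient: "ends X e = Upair (fst (orient X e)) (snd (orient X e))"
proof -
  obtain a b where "ends X e = Upair a b"
    by (cases "ends X e") auto
  then have "\<exists>p. case p of (a, b) \<Rightarrow> ends X e = Upair a b"
    by auto
  then have "case orient X e of (a, b) \<Rightarrow> ends X e = Upair a b"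
    unfolding orient_def by (rule someI_ex)
  then show ?thesis
    by (simp add: case_prod_beta)
qed

definition open_edge :: "'e \<Rightarrow> ('v, 'e) point set" where
  "open_edge e = Inner e ` {0<..<1}"

definition points :: "('v, 'e) multigraph \<Rightarrow> ('v, 'e) point set" where
  "points X = Vertex ` verts X \<union> (\<Union>e\<in>edges X. open_edge e)"

text \<open>The characteristic map of the 1-cell \<open>e\<close>, defined on the unit interval.\<close>

definition char_map :: "('v, 'e) multigraph \<Rightarrow> 'e \<Rightarrow> real \<Rightarrow> ('v, 'e) point" where
  "char_map X e t =
     (if t = 0 then Vertex (fst (orient X e))
      else if t = 1 then Vertex (snd (orient X e))
      else Inner e t)"

text \<open>The CW topology, i.e. the quotient of the disjoint union of the discrete space of vertices
  and one unit interval for each edge.\<close>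

definition realization :: "('v, 'e) multigraph \<Rightarrow> ('v, 'e) point topology" where
  "realization X = topology (\<lambda>U. U \<subseteq> points X \<and>
     (\<forall>e\<in>edges X. openin (top_of_set {0..1}) {t\<in>{0..1}. char_map X e t \<in> U}))"

lemma openin_realization:
  "openin (realization X) U \<longleftrightarrow> U \<subseteq> points X \<and>
     (\<forall>e\<in>edges X. openin (top_of_set {0..1}) {t\<in>{0..1}. char_map X e t \<in> U})"
proof -
  have "istopology (\<lambda>U. U \<subseteq> points X \<and>
     (\<forall>e\<in>edges X. openin (top_of_set {0..1}) {t\<in>{0..1}. char_map X e t \<in> U}))"
    unfolding istopology_def
  proof (rule conjI; intro allI impI conjI ballI)
    fix S T e
    assume S: "S \<subseteq> points X \<and>
        (\<forall>e\<in>edges X. openin (top_of_set {0..1}) {t\<in>{0..1}. char_map X e t \<in> S})"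
      and T: "T \<subseteq> points X \<and>
        (\<forall>e\<in>edges X. openin (top_of_set {0..1}) {t\<in>{0..1}. char_map X e t \<in> T})"
    show "S \<inter> T \<subseteq> points X" using S by auto
    assume "e \<in> edges X"
    moreover have "{t\<in>{0..1}. char_map X e t \<in> S \<inter> T} =
        {t\<in>{0..1}. char_map X e t \<in> S} \<inter> {t\<in>{0..1}. char_map X e t \<in> T}" by auto
    ultimately show "openin (top_of_set {0..1}) {t\<in>{0..1}. char_map X e t \<in> S \<inter> T}"
      using S T by (simp only:) blast
  next
    fix K e
    assume K: "\<forall>S\<in>K. S \<subseteq> points X \<and>
        (\<forall>e\<in>edges X. openin (top_of_set {0..1}) {t\<in>{0..1}. char_map X e t \<in> S})"
    show "\<Union>K \<subseteq> points X" using K by auto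
    assume "e \<in> edges X"
    moreover have "{t\<in>{0..1}. char_map X e t \<in> \<Union>K} =
        \<Union>((\<lambda>S. {t\<in>{0..1}. char_map X e t \<in> S}) ` K)" by auto
    ultimately show "openin (top_of_set {0..1}) {t\<in>{0..1}. char_map X e t \<in> \<Union>K}"
      using K by (simp only:) blast
  qed
  then show ?thesis
    unfolding realization_def by (simp add: topology_inverse')
qed

lemma topspace_realization:
  assumes "multigraph X"
  shows "topspace (realization X) = points X"
proof -
  have "char_map X e t \<in> points X" if "e \<in> edges X" "t \<in> {0..1}" for e t
    using that assms ends_orient[of X e]
    by (force simp: multigraph_def char_map_def points_def open_edge_def)
  then have "{t\<in>{0..1}. char_map X e t \<in> points X} = {0..1}" if "e \<in> edges X" for e
    using that by auto
  then have "openin (realization X) (points X)"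
    unfolding openin_realization using openin_topspace[of "top_of_set {0..1::real}"] by simp
  then show ?thesis
    using openin_realization[of X "topspace (realization X)"] openin_subset by fastforce
qed


section \<open>Covers\<close>

text \<open>The library's \<open>covering_space\<close>, restated for topologies that do not come from a type class.\<close>

definition covering_map :: "'a topology \<Rightarrow> 'b topology \<Rightarrow> ('a \<Rightarrow> 'b) \<Rightarrow> bool" where
  "covering_map C S p \<longleftrightarrow>
     continuous_map C S p \<and> p ` topspace C = topspace S \<and>
     (\<forall>x\<in>topspace S. \<exists>T. x \<in> T \<and> openin S T \<and>
        (\<exists>\<V>. \<Union>\<V> = topspace C \<inter> p -` T \<and>
             (\<forall>U\<in>\<V>. openin C U) \<and>
             pairwise disjnt \<V> \<and>
             (\<forall>U\<in>\<V>. homeomorphic_map (subtopology C U) (subtopology S T) p)))"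

text \<open>Morphisms are maps of the realizations rather than pairs of maps of vertices and edges,
  because the latter do not record which way round an edge is mapped onto a loop.\<close>

definition is_morphism ::
  "('w, 'f) multigraph \<Rightarrow> ('v, 'e) multigraph \<Rightarrow> (('w, 'f) point \<Rightarrow> ('v, 'e) point) \<Rightarrow> bool" where
  "is_morphism Y X \<pi> \<longleftrightarrow>
     continuous_map (realization Y) (realization X) \<pi> \<and>
     (\<exists>f g. f \<in> verts Y \<rightarrow> verts X \<and> g \<in> edges Y \<rightarrow> edges X \<and>
        (\<forall>e\<in>edges Y. ends X (g e) = map_uprod f (ends Y e)) \<and>
        (\<forall>v\<in>verts Y. \<pi> (Vertex v) = Vertex (f v)) \<and>
        (\<forall>e\<in>edges Y. \<pi> ` open_edge e = open_edge (g e)))"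

definition is_cover ::
  "('w, 'f) multigraph \<Rightarrow> ('v, 'e) multigraph \<Rightarrow> (('w, 'f) point \<Rightarrow> ('v, 'e) point) \<Rightarrow> bool" where
  "is_cover Y X \<pi> \<longleftrightarrow>
     is_morphism Y X \<pi> \<and> covering_map (realization Y) (realization X) \<pi>"

definition deck_transformations :: "'a topology \<Rightarrow> ('a \<Rightarrow> 'b) \<Rightarrow> ('a \<Rightarrow> 'a) set" where
  "deck_transformations C p =
     {h \<in> extensional (topspace C). homeomorphic_map C C h \<and> (\<forall>x\<in>topspace C. p (h x) = p x)}"

definition deck_group :: "'a topology \<Rightarrow> ('a \<Rightarrow> 'b) \<Rightarrow> ('a \<Rightarrow> 'a) monoid" where
  "deck_group C p = BijGroup (topspace C)\<lparr>carrier := deck_transformations C p\<rparr>"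

lemma subgroup_deck_transformations:
  "subgroup (deck_transformations C p) (BijGroup (topspace C))"
proof -
  let ?S = "topspace C"
  interpret group "BijGroup ?S" by (rule group_BijGroup)
  have Bij: "h \<in> Bij ?S" if "h \<in> deck_transformations C p" for h
    using that
    by (auto simp: deck_transformations_def Bij_def bij_betw_def
        homeomorphic_imp_surjective_map homeomorphic_imp_injective_map)
  show ?thesis
  proof
    show "deck_transformations C p \<subseteq> carrier (BijGroup ?S)"
      using Bij by (auto simp: BijGroup_def)
    have "homeomorphic_map C C (\<lambda>x\<in>?S. x)"
      by (rule homeomorphic_map_eq[where f = id]) auto
    then show "\<one>\<^bsub>BijGroup ?S\<^esub> \<in> deck_transformations C p"
      by (auto simp: BijGroup_def deck_transformations_def)
  next
    fix h k
    assume h: "h \<in> deck_transformations C p" and k: "k \<in> deck_transformations C p"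
    have "homeomorphic_map C C (compose ?S h k)"
      by (rule homeomorphic_map_eq[OF homeomorphic_map_compose[of C C k C h]])
        (use h k in \<open>auto simp: deck_transformations_def compose_def\<close>)
    moreover have "k x \<in> ?S" if "x \<in> ?S" for x
      using Bij[OF k] that Bij_imp_funcset by blast
    ultimately show "h \<otimes>\<^bsub>BijGroup ?S\<^esub> k \<in> deck_transformations C p"
      using h k Bij by (auto simp: BijGroup_def deck_transformations_def compose_def)
  next
    fix h
    assume h: "h \<in> deck_transformations C p"
    let ?g = "\<lambda>x\<in>?S. inv_into ?S h x"
    have hh: "homeomorphic_map C C h"
      using h by (simp add: deck_transformations_def)
    obtain g where g: "homeomorphic_maps C C h g"
      using hh by (auto simp: homeomorphic_map_maps)
    have inj: "inj_on h ?S" and im: "h ` ?S = ?S"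
      using hh by (auto simp: homeomorphic_imp_surjective_map homeomorphic_imp_injective_map)
    have gS: "g x \<in> ?S" "h (g x) = x" if "x \<in> ?S" for x
      using g that by (auto simp: homeomorphic_maps_def continuous_map_def)
    have eq: "g x = ?g x" if "x \<in> ?S" for x
      using that gS inj by (metis inv_into_f_f restrict_apply')
    have "homeomorphic_map C C g"
      using g homeomorphic_maps_map by blast
    then have "homeomorphic_map C C ?g"
      by (rule homeomorphic_map_eq) (use eq in auto)
    moreover have "p (?g x) = p x" if "x \<in> ?S" for x
      using h gS[OF that] eq[OF that] unfolding deck_transformations_def by force
    ultimately have "?g \<in> deck_transformations C p"
      by (simp add: deck_transformations_def)
    then show "inv\<^bsub>BijGroup ?S\<^esub> h \<in> deck_transformations C p"
      by (simp add: inv_BijGroup Bij[OF h])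
  qed
qed

lemma group_deck_group: "group (deck_group C p)"
  unfolding deck_group_def
  by (rule subgroup.subgroup_is_group[OF subgroup_deck_transformations group_BijGroup])

definition galois_cover ::
  "('w, 'f) multigraph \<Rightarrow> ('v, 'e) multigraph \<Rightarrow> (('w, 'f) point \<Rightarrow> ('v, 'e) point) \<Rightarrow> bool" where
  "galois_cover Y X \<pi> \<longleftrightarrow> is_cover Y X \<pi> \<and>
     (\<forall>y\<in>topspace (realization Y). \<forall>z\<in>topspace (realization Y). \<pi> y = \<pi> z \<longrightarrow>
        (\<exists>h\<in>carrier (deck_group (realization Y) \<pi>). h y = z))"

definition abelian_cover ::
  "('w, 'f) multigraph \<Rightarrow> ('v, 'e) multigraph \<Rightarrow> (('w, 'f) point \<Rightarrow> ('v, 'e) point) \<Rightarrow> bool" where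
  "abelian_cover Y X \<pi> \<longleftrightarrow> galois_cover Y X \<pi> \<and> comm_group (deck_group (realization Y) \<pi>)"

end

(*
  Pushing divisors forward along the vertex map f of the cover intertwines the Laplacians, because
  the cover is bijective on the germs of edges at each vertex.  So f maps the Jacobian of Y onto
  that of X, and the orders of the Jacobians are the numbers of spanning trees.  In matrices: let
  A and B be the Laplacians of X and Y with 1 added at one diagonal entry, at vertices x0 = f y0
  and y0, so that det A and det B count spanning trees, and let P be the 0-1 matrix of f.
  Then P B = A P' for an integral P', and P has an integral right inverse, hence det A divides det B.
*)
theory Submission
  imports Defs "Jordan_Normal_Form.Determinant" "HOL-Library.Transitive_Closure_Table"
begin

text \<open>The cover is given as a topological covering map that sends open edges onto open edges
  without respecting their parameters. The bijection on germs therefore has to be extracted from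
  local homeomorphisms, by following connected images of short arcs. Only the number of germs over
  each edge is compared: all germs of one edge at one vertex contribute equally to the Laplacian, a
  loop contributing 0, so counts suffice.

  Deleting a row and a column from each Laplacian would spoil the intertwining, because the fibre of
  x0 may contain vertices other than y0. Adding 1 at a diagonal entry keeps all vertices. The defect
  it causes is, in every column, a multiple of the unit vector at x0, which is the image under A of
  the constant vector; subtracting it turns P into P'.

  P is rectangular, so P B = A P' offers no determinants to compare. The right inverse splits off
  the kernel of P, and B is factored through a square matrix with the determinant of A.\<close>

hide_const (open) Determinants.det
no_notation vec_nth (infixl \<open>$\<close> 90)

section \<open>Covers near a vertex\<close>

text \<open>The dart \<open>(e, True)\<close> is the end of \<open>e\<close> at parameter 0, and \<open>(e, False)\<close> the one at parameter 1; a loop has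
  two darts at its vertex.\<close>

definition dart_source :: "('v, 'e) multigraph \<Rightarrow> 'e \<times> bool \<Rightarrow> 'v" where
  "dart_source G d = (if snd d then fst (orient G (fst d)) else snd (orient G (fst d)))"

definition darts :: "('v, 'e) multigraph \<Rightarrow> 'e set \<Rightarrow> 'v \<Rightarrow> ('e \<times> bool) set" where
  "darts G E v = {d \<in> E \<times> UNIV. dart_source G d = v}"

definition dart_arc :: "('v, 'e) multigraph \<Rightarrow> 'e \<times> bool \<Rightarrow> real \<Rightarrow> ('v, 'e) point" where
  "dart_arc G d s = char_map G (fst d) (if snd d then s else 1 - s)"

text \<open>Each dart has a radius of its own, so that one arc can be cut short while the others
  keep their length.\<close>

definition star :: "('v, 'e) multigraph \<Rightarrow> 'v \<Rightarrow> ('e \<times> bool \<Rightarrow> real) \<Rightarrow> ('v, 'e) point set" where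
  "star G v \<rho> = insert (Vertex v) (\<Union>d\<in>darts G (edges G) v. dart_arc G d ` {0<..<\<rho> d})"

lemma finite_darts: "finite E \<Longrightarrow> finite (darts G E v)"
  by (rule finite_subset[of _ "E \<times> UNIV"]) (auto simp: darts_def)

lemma dart_arc_0: "dart_arc G d 0 = Vertex (dart_source G d)"
  by (simp add: dart_arc_def char_map_def dart_source_def)

lemma dart_arc_inner:
  "0 < s \<Longrightarrow> s < 1 \<Longrightarrow> dart_arc G d s = Inner (fst d) (if snd d then s else 1 - s)"
  by (simp add: dart_arc_def char_map_def)

text \<open>Below parameter 1/2 the two darts of an edge run through disjoint halves of it. This is
  the origin of the bound 1/2 on all radii.\<close>

lemma dart_arc_eq_iff:
  assumes "0 < s" "s < 1/2" "0 < t" "t < 1/2"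
  shows "dart_arc G d s = dart_arc G c t \<longleftrightarrow> d = c \<and> s = t"
  using assms by (cases d; cases c) (auto simp: dart_arc_inner)

section \<open>Open sets and arcs in the CW topology\<close>

lemma orient_in_verts:
  assumes "multigraph G" "e \<in> edges G"
  shows "fst (orient G e) \<in> verts G" "snd (orient G e) \<in> verts G"
  using assms ends_orient[of G e] by (auto simp: multigraph_def)

lemma char_map_in_points:
  assumes "multigraph G" "e \<in> edges G" "t \<in> {0..1}"
  shows "char_map G e t \<in> points G"
  using assms orient_in_verts[of G e] by (force simp: char_map_def points_def open_edge_def)

lemma openin_interval_ray:
  "openin (top_of_set {0..1}) ({0..1} \<inter> {..<a::real})"
  "openin (top_of_set {0..1}) ({0..1} \<inter> {a::real<..})"
  by (auto intro: openin_open_Int)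

text \<open>Pulled back to the unit interval of an edge, a star is an initial piece if the edge
  starts at \<open>v\<close>, together with a final piece if it ends there. These pieces are
  \<open>?a\<close> and \<open>?b\<close>, and both are relatively open.\<close>

lemma openin_star:
  fixes G :: "('v, 'e) multigraph"
  assumes G: "multigraph G" and v: "v \<in> verts G"
    and \<rho>: "\<And>d. d \<in> darts G (edges G) v \<Longrightarrow> 0 < \<rho> d \<and> \<rho> d \<le> 1/2"
  shows "openin (realization G) (star G v \<rho>)"
  unfolding openin_realization
proof (intro conjI ballI)
  show "star G v \<rho> \<subseteq> points G"
    using v \<rho> by (fastforce simp: star_def points_def open_edge_def darts_def dart_arc_inner)
  fix e assume e: "e \<in> edges G"
  let ?a = "if dart_source G (e, True) = v then {0..1} \<inter> {..<\<rho> (e, True)} else {}"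
  let ?b = "if dart_source G (e, False) = v then {0..1} \<inter> {1 - \<rho> (e, False)<..} else {}"
  have \<rho>T: "dart_source G (e, True) = v \<Longrightarrow> 0 < \<rho> (e, True) \<and> \<rho> (e, True) \<le> 1/2"
    and \<rho>F: "dart_source G (e, False) = v \<Longrightarrow> 0 < \<rho> (e, False) \<and> \<rho> (e, False) \<le> 1/2"
    using \<rho>[of "(e, True)"] \<rho>[of "(e, False)"] e by (auto simp: darts_def)
  have inner: "Inner e t \<in> star G v \<rho> \<longleftrightarrow>
      dart_source G (e, True) = v \<and> t < \<rho> (e, True) \<or>
      dart_source G (e, False) = v \<and> 1 - t < \<rho> (e, False)" if t: "0 < t" "t < 1" for t
  proof -
    have "Inner e t \<in> dart_arc G d ` {0<..<\<rho> d} \<longleftrightarrow>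
        fst d = e \<and> (if snd d then t < \<rho> d else 1 - t < \<rho> d)"
      if "d \<in> darts G (edges G) v" for d
    proof -
      have "Inner e t \<in> dart_arc G d ` {0<..<\<rho> d} \<longleftrightarrow>
         (\<exists>s. 0 < s \<and> s < \<rho> d \<and> (Inner e t :: ('v, 'e) point) = Inner (fst d) (if snd d then s else 1 - s))"
        using \<rho>[OF that] dart_arc_inner[of _ G d] by (fastforce simp: image_iff)
      also have "\<dots> \<longleftrightarrow> fst d = e \<and> (if snd d then t < \<rho> d else 1 - t < \<rho> d)"
        using t by (auto intro: exI[of _ "1 - t"])
      finally show ?thesis .
    qed
    then have "Inner e t \<in> star G v \<rho> \<longleftrightarrow> (\<exists>d\<in>darts G (edges G) v.
        fst d = e \<and> (if snd d then t < \<rho> d else 1 - t < \<rho> d))"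
      by (simp add: star_def)
    also have "\<dots> \<longleftrightarrow> (\<exists>b. dart_source G (e, b) = v \<and> (if b then t < \<rho> (e, b) else 1 - t < \<rho> (e, b)))"
      using e by (auto simp: darts_def)
    finally show ?thesis by (metis (full_types))
  qed
  have vertex: "Vertex u \<in> star G v \<rho> \<longleftrightarrow> u = v" for u
    using \<rho> by (force simp: star_def dart_arc_inner)
  have "{t \<in> {0..1}. char_map G e t \<in> star G v \<rho>} = ?a \<union> ?b"
  proof (rule Set.set_eqI)
    fix t :: real
    consider "t < 0 \<or> t > 1" | "t = 0" | "t = 1" | "0 < t" "t < 1" by linarith
    then show "t \<in> {t \<in> {0..1}. char_map G e t \<in> star G v \<rho>} \<longleftrightarrow> t \<in> ?a \<union> ?b"
    proof cases
      case 2
      then show ?thesis using \<rho>T \<rho>F by (auto simp: char_map_def vertex dart_source_def)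
    next
      case 3
      then show ?thesis using \<rho>T \<rho>F by (auto simp: char_map_def vertex dart_source_def)
    next
      case 4
      then show ?thesis by (auto simp: char_map_def inner)
    qed auto
  qed
  moreover have "openin (top_of_set {0..1}) ?a" "openin (top_of_set {0..1}) ?b"
    by (simp_all only: openin_interval_ray openin_empty split: if_split) simp_all
  ultimately show "openin (top_of_set {0..1}) {t \<in> {0..1}. char_map G e t \<in> star G v \<rho>}"
    by (simp only: openin_Un)
qed

lemma openin_subarc:
  assumes e: "fst d \<in> edges G" and ab: "0 \<le> a" "b \<le> 1"
  shows "openin (realization G) (dart_arc G d ` {a<..<b})"
  unfolding openin_realization
proof (intro conjI ballI)
  show "dart_arc G d ` {a<..<b} \<subseteq> points G"
    using e ab by (force simp: points_def open_edge_def dart_arc_inner)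
  fix e' assume "e' \<in> edges G"
  have iff: "char_map G e' t \<in> dart_arc G d ` {a<..<b} \<longleftrightarrow>
      e' = fst d \<and> (if snd d then t else 1 - t) \<in> {a<..<b}" if "t \<in> {0..1}" for t
  proof
    assume "char_map G e' t \<in> dart_arc G d ` {a<..<b}"
    then show "e' = fst d \<and> (if snd d then t else 1 - t) \<in> {a<..<b}"
      using ab by (auto simp: dart_arc_inner char_map_def split: if_splits)
  next
    assume *: "e' = fst d \<and> (if snd d then t else 1 - t) \<in> {a<..<b}"
    then have "char_map G e' t = dart_arc G d (if snd d then t else 1 - t)"
      by (simp add: dart_arc_def)
    then show "char_map G e' t \<in> dart_arc G d ` {a<..<b}" using * by blast
  qed
  have "{t \<in> {0..1}. char_map G e' t \<in> dart_arc G d ` {a<..<b}} =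
      {t \<in> {0..1}. e' = fst d \<and> (if snd d then t else 1 - t) \<in> {a<..<b}}"
    using iff by blast
  also have "\<dots> = {0..1} \<inter> (if e' \<noteq> fst d then {} else if snd d then {a<..<b} else {1 - b<..<1 - a})"
    by auto
  finally have "{t \<in> {0..1}. char_map G e' t \<in> dart_arc G d ` {a<..<b}} = \<dots>" .
  then show "openin (top_of_set {0..1}) {t \<in> {0..1}. char_map G e' t \<in> dart_arc G d ` {a<..<b}}"
    by (simp del: openin_Int add: openin_open_Int)
qed

lemma continuous_map_dart_arc:
  assumes "multigraph G" "fst d \<in> edges G"
  shows "continuous_map (top_of_set {0..1}) (realization G) (dart_arc G d)"
proof -
  have char: "continuous_map (top_of_set {0..1}) (realization G) (char_map G (fst d))"
    using assms by (auto simp: continuous_map_def topspace_realization openin_realization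
        char_map_in_points)
  have "continuous_map (top_of_set {0..1::real}) (top_of_set {0..1}) (\<lambda>s. if snd d then s else 1 - s)"
    by (auto simp: continuous_map_in_subtopology intro!: continuous_intros)
  from continuous_map_compose[OF this char] show ?thesis
    by (simp add: dart_arc_def[abs_def] o_def)
qed

text \<open>A point in the interior of an arc disconnects a star, so the image of a short arc at \<open>v\<close>, which is
  connected and contains \<open>w\<close>, covers an initial piece of some arc at \<open>w\<close>. Different arcs at \<open>v\<close>
  give different arcs at \<open>w\<close> by injectivity.\<close>

lemma card_darts_le:
  fixes G :: "('v, 'e) multigraph" and H :: "('w, 'f) multigraph"
  assumes G: "multigraph G" and H: "multigraph H"
    and E: "E \<subseteq> edges G" and F: "F \<subseteq> edges H" and fin: "finite F"
    and U: "openin (realization G) U" and v: "Vertex v \<in> U" and w: "w \<in> verts H"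
    and h: "continuous_map (subtopology (realization G) U) (realization H) h" "inj_on h U"
      "h (Vertex v) = Vertex w"
    and hE: "\<And>e p. e \<in> E \<Longrightarrow> p \<in> U \<inter> open_edge e \<Longrightarrow> \<exists>f\<in>F. h p \<in> open_edge f"
  shows "card (darts G E v) \<le> card (darts H F w)"
proof -
  \<comment> \<open>All parameters below \<open>r1\<close> are reached, rather than a single one, so
    that two darts assigned the same \<open>c\<close> can later be compared at a common
    parameter.\<close>
  have ex: "\<exists>c\<in>darts H F w. \<exists>r1>0. \<forall>r. 0 < r \<and> r < r1 \<longrightarrow>
      (\<exists>s. 0 < s \<and> s < 1/2 \<and> dart_arc G d s \<in> U \<and> h (dart_arc G d s) = dart_arc H c r)"
    if d: "d \<in> darts G E v" for d
  proof -
    let ?a = "dart_arc G d" and ?H = "realization H"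
    let ?S = "star H w (\<lambda>_. 1/2)"
    have dE: "fst d \<in> E" "dart_source G d = v"
      using d by (auto simp: darts_def)
    have cont: "continuous_map (top_of_set {0..1}) (realization G) ?a"
      using G E dE by (intro continuous_map_dart_arc) auto
    have hU: "openin (realization G) {p \<in> U. h p \<in> ?S}"
    proof -
      have "openin (subtopology (realization G) U)
          {p \<in> topspace (subtopology (realization G) U). h p \<in> ?S}"
        using h(1) w H by (intro openin_continuous_map_preimage) (auto intro: openin_star)
      moreover have "topspace (subtopology (realization G) U) = U"
        using openin_subset[OF U] by auto
      ultimately show ?thesis
        using U openin_trans_full by fastforce
    qed
    have "openin (top_of_set {0..1}) {s \<in> {0..1}. ?a s \<in> {p \<in> U. h p \<in> ?S}}"
      using openin_continuous_map_preimage[OF cont hU] by simp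
    moreover have "0 \<in> {s \<in> {0..1}. ?a s \<in> {p \<in> U. h p \<in> ?S}}"
      using v dE h(3) by (simp add: dart_arc_0 star_def)
    ultimately obtain \<epsilon> where \<epsilon>: "\<epsilon> > 0"
      "\<And>s. s \<in> {0..1} \<Longrightarrow> dist s 0 < \<epsilon> \<Longrightarrow> ?a s \<in> {p \<in> U. h p \<in> ?S}"
      unfolding openin_euclidean_subtopology_iff by blast
    \<comment> \<open>Half of \<epsilon> places the closed interval up to \<open>s1\<close> inside
      the open ball; \<open>1/4\<close> keeps it below 1/2, where points determine their
      darts.\<close>
    define s1 where "s1 = min (1/4) (\<epsilon>/2)"
    have s1: "0 < s1" "s1 < 1/2" and aU: "?a s \<in> U" "h (?a s) \<in> ?S" if "s \<in> {0..s1}" for s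
      using \<epsilon> that by (auto simp: s1_def dist_real_def)
    have s1': "0 < s1" "s1 < 1/2" using \<epsilon>(1) by (auto simp: s1_def)
    let ?K = "(h \<circ> ?a) ` {0..s1}"
    have K: "connectedin ?H ?K"
    proof (rule connectedin_continuous_map_image)
      have "continuous_map (top_of_set {0..s1}) (subtopology (realization G) U) ?a"
        using cont s1' aU
        by (auto simp: continuous_map_in_subtopology intro: continuous_map_from_subtopology_mono)
      then show "continuous_map (top_of_set {0..s1}) ?H (h \<circ> ?a)"
        using h(1) by (rule continuous_map_compose)
      show "connectedin (top_of_set {0..s1}) {0..s1}"
        by (simp add: connectedin_subtopology)
    qed
    have "?a s1 \<in> U \<inter> open_edge (fst d)"
      using aU[of s1] s1' by (auto simp: open_edge_def dart_arc_inner)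
    with hE dE obtain f where f: "f \<in> F" "h (?a s1) \<in> open_edge f" by blast
    have "h (?a s1) \<in> ?S" using aU s1' by simp
    then obtain c r1 where c: "c \<in> darts H (edges H) w" "0 < r1" "r1 < 1/2" "h (?a s1) = dart_arc H c r1"
      using f by (auto simp: star_def open_edge_def)
    have cF: "c \<in> darts H F w"
      using c f by (auto simp: darts_def open_edge_def dart_arc_inner)
    have "\<exists>s. 0 < s \<and> s < 1/2 \<and> ?a s \<in> U \<and> h (?a s) = dart_arc H c r" if r: "0 < r" "r < r1" for r
    proof -
      \<comment> \<open>\<open>?A\<close> and \<open>?B\<close> are disjoint open sets that together
        omit exactly one point of \<open>?S\<close>, the one on \<open>c\<close> at parameter
        \<open>r\<close>. Both meet the connected set \<open>?K\<close>, so \<open>?K\<close> must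
        contain that point.\<close>
      let ?A = "star H w ((\<lambda>_. 1/2)(c := r))" and ?B = "dart_arc H c ` {r<..<1/2}"
      have oA: "openin ?H ?A" and oB: "openin ?H ?B"
        using w H r c by (auto intro!: openin_star openin_subarc simp: darts_def)
      have AB: "?A \<inter> ?B = {}"
        using r c by (cases c) (auto simp: star_def dart_arc_inner split: if_splits)
      have "Vertex w \<in> ?A \<inter> ?K"
        using s1' dE h(3) by (auto simp: star_def dart_arc_0 intro!: image_eqI[of _ _ 0])
      moreover have "dart_arc H c r1 \<in> ?B \<inter> ?K"
        using s1' c r by (auto intro!: image_eqI[of _ _ s1])
      ultimately have "\<not> ?K \<subseteq> ?A \<union> ?B"
        using K oA oB AB unfolding connectedin by blast
      then have "\<exists>s\<in>{0..s1}. h (?a s) \<notin> ?A \<union> ?B"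
        unfolding image_subset_iff o_apply by blast
      then obtain s where s: "s \<in> {0..s1}" "h (?a s) \<notin> ?A" "h (?a s) \<notin> ?B" by blast
      have "h (?a s) \<noteq> Vertex w"
        using s(2) by (auto simp: star_def)
      then obtain c' t where t: "c' \<in> darts H (edges H) w" "0 < t" "t < 1/2"
          "h (?a s) = dart_arc H c' t"
        using aU(2)[OF s(1)] by (auto simp: star_def)
      have "\<not> t < ((\<lambda>_. 1/2)(c := r)) c'"
        using s(2) t by (force simp: star_def)
      with t(3) have "c' = c" "r \<le> t" by (auto split: if_splits)
      moreover have "\<not> r < t" using s(3) t \<open>c' = c\<close> by auto
      ultimately have "h (?a s) = dart_arc H c r"
        using t(4) by simp
      moreover have "s \<noteq> 0"
        using s dE h(3) by (auto simp: star_def dart_arc_0)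
      ultimately show ?thesis using s aU[of s] s1' by auto
    qed
    then show ?thesis using cF c(2) by blast
  qed
  then obtain \<phi> r1 where \<phi>: "\<And>d. d \<in> darts G E v \<Longrightarrow> \<phi> d \<in> darts H F w"
    "\<And>d. d \<in> darts G E v \<Longrightarrow> r1 d > (0::real)"
    "\<And>d r. d \<in> darts G E v \<Longrightarrow> 0 < r \<Longrightarrow> r < r1 d \<Longrightarrow>
      (\<exists>s. 0 < s \<and> s < 1/2 \<and> dart_arc G d s \<in> U \<and> h (dart_arc G d s) = dart_arc H (\<phi> d) r)"
    by metis
  have "inj_on \<phi> (darts G E v)"
  proof
    fix d d' assume d: "d \<in> darts G E v" "d' \<in> darts G E v" "\<phi> d = \<phi> d'"
    define r where "r = min (r1 d) (r1 d') / 2"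
    have r: "0 < r" "r < r1 d" "r < r1 d'" using \<phi>(2)[OF d(1)] \<phi>(2)[OF d(2)] by (auto simp: r_def)
    obtain s s' where s: "0 < s" "s < 1/2" "dart_arc G d s \<in> U" "h (dart_arc G d s) = dart_arc H (\<phi> d) r"
       "0 < s'" "s' < 1/2" "dart_arc G d' s' \<in> U" "h (dart_arc G d' s') = dart_arc H (\<phi> d) r"
      using \<phi>(3)[OF d(1) r(1,2)] \<phi>(3)[OF d(2) r(1,3)] d(3) by auto
    then have "dart_arc G d s = dart_arc G d' s'"
      by (intro inj_onD[OF h(2)]) simp_all
    then show "d = d'" using s by (simp add: dart_arc_eq_iff)
  qed
  then show ?thesis
    using \<phi>(1) finite_darts[OF fin] by (intro card_inj_on_le) auto
qed

section \<open>Vertices and germs under a covering map\<close>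

text \<open>A covering map is onto, and interior points of edges go to interior points of edges, so
  any point over a vertex is a vertex.\<close>

lemma cover_surj_on_verts:
  assumes Y: "multigraph Y" and X: "multigraph X" and cov: "covering_map (realization Y) (realization X) \<pi>"
    and f: "\<And>v. v \<in> verts Y \<Longrightarrow> \<pi> (Vertex v) = Vertex (f v)"
    and g: "\<And>e. e \<in> edges Y \<Longrightarrow> \<pi> ` open_edge e = open_edge (g e)"
    and x: "x \<in> verts X"
  obtains y where "y \<in> verts Y" "f y = x"
proof -
  have "Vertex x \<in> \<pi> ` points Y"
    using cov x by (auto simp: covering_map_def topspace_realization X Y points_def)
  then obtain p where p: "p \<in> points Y" "\<pi> p = Vertex x" by auto
  have "p \<notin> open_edge e" if "e \<in> edges Y" for e
  proof
    assume "p \<in> open_edge e"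
    then have "\<pi> p \<in> open_edge (g e)" using g[OF that] by blast
    then show False using p by (auto simp: open_edge_def)
  qed
  then obtain y where "y \<in> verts Y" "p = Vertex y" using p by (auto simp: points_def)
  then show ?thesis using that f p by auto
qed

text \<open>On a sheet \<open>U\<close> through \<open>y\<close> the projection is a homeomorphism
  onto a neighbourhood \<open>T\<close> of \<open>f y\<close>. Applying \<open>card_darts_le\<close>
  to it and to its inverse gives the two inequalities. The count is made over a single edge
  \<open>e\<close>, which is the refinement that the Laplacian requires.\<close>

lemma card_darts_cover:
  assumes Y: "finite_multigraph Y" and X: "finite_multigraph X"
    and cov: "covering_map (realization Y) (realization X) \<pi>"
    and fV: "f \<in> verts Y \<rightarrow> verts X"
    and f: "\<And>v. v \<in> verts Y \<Longrightarrow> \<pi> (Vertex v) = Vertex (f v)"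
    and g: "\<And>e. e \<in> edges Y \<Longrightarrow> \<pi> ` open_edge e = open_edge (g e)"
    and y: "y \<in> verts Y" and e: "e \<in> edges X"
  shows "card (darts Y {e' \<in> edges Y. g e' = e} y) = card (darts X {e} (f y))"
proof -
  let ?RX = "realization X" and ?RY = "realization Y"
  have mX: "multigraph X" and mY: "multigraph Y" and finY: "finite (edges Y)"
    using X Y by (auto simp: finite_multigraph_def)
  note [simp] = topspace_realization[OF mX] topspace_realization[OF mY]
  have fy: "f y \<in> verts X" using fV y by auto
  have "Vertex (f y) \<in> topspace ?RX" using fy by (simp add: points_def)
  then obtain T \<V> where T: "Vertex (f y) \<in> T" "openin ?RX T"
      "\<Union>\<V> = topspace ?RY \<inter> \<pi> -` T" "\<forall>U\<in>\<V>. openin ?RY U"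
      "\<forall>U\<in>\<V>. homeomorphic_map (subtopology ?RY U) (subtopology ?RX T) \<pi>"
    using cov unfolding covering_map_def by blast
  have "Vertex y \<in> \<Union>\<V>"
    using T(1,3) y f by (auto simp: points_def)
  then obtain U where U: "U \<in> \<V>" "Vertex y \<in> U" by auto
  have oU: "openin ?RY U" and hU: "homeomorphic_map (subtopology ?RY U) (subtopology ?RX T) \<pi>"
    using T U by auto
  then obtain \<psi> where \<psi>: "homeomorphic_maps (subtopology ?RY U) (subtopology ?RX T) \<pi> \<psi>"
    by (auto simp: homeomorphic_map_maps)
  have topU: "topspace (subtopology ?RY U) = U" and topT: "topspace (subtopology ?RX T) = T"
    using openin_subset[OF oU] openin_subset[OF T(2)] by auto
  have c\<pi>: "continuous_map (subtopology ?RY U) ?RX \<pi>"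
    and c\<psi>: "continuous_map (subtopology ?RX T) ?RY \<psi>"
    using \<psi> by (auto simp: homeomorphic_maps_def continuous_map_in_subtopology)
  have \<psi>\<pi>: "\<psi> (\<pi> p) = p" if "p \<in> U" for p
    using \<psi> that topU by (auto simp: homeomorphic_maps_def)
  have \<pi>\<psi>: "\<pi> (\<psi> p) = p" "\<psi> p \<in> U" if "p \<in> T" for p
    using \<psi> that topT topU by (auto simp: homeomorphic_maps_def continuous_map_in_subtopology)
  have disj: "e1 = e2" if "p \<in> open_edge e1" "p \<in> open_edge e2" for p :: "('a, 'b) point" and e1 e2
    using that by (auto simp: open_edge_def)
  show ?thesis
  proof (rule antisym)
    show "card (darts Y {e' \<in> edges Y. g e' = e} y) \<le> card (darts X {e} (f y))"
    proof (rule card_darts_le[OF mY mX _ _ _ oU U(2) fy c\<pi>])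
      show "inj_on \<pi> U" using \<psi>\<pi> by (metis inj_onI)
      show "\<exists>f\<in>{e}. \<pi> p \<in> open_edge f"
        if "e' \<in> {e' \<in> edges Y. g e' = e}" "p \<in> U \<inter> open_edge e'" for e' p
        using that g[of e'] by auto
    qed (use f y e in auto)
    show "card (darts X {e} (f y)) \<le> card (darts Y {e' \<in> edges Y. g e' = e} y)"
    proof (rule card_darts_le[OF mX mY _ _ _ T(2,1) y c\<psi>])
      show "inj_on \<psi> T" using \<pi>\<psi> by (metis inj_onI)
      show "\<psi> (Vertex (f y)) = Vertex y" using \<psi>\<pi>[OF U(2)] f[OF y] by simp
      show "\<exists>e'\<in>{e' \<in> edges Y. g e' = e}. \<psi> p \<in> open_edge e'"
        if "e1 \<in> {e}" "p \<in> T \<inter> open_edge e1" for e1 p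
      proof -
        have p: "p \<in> T" "p \<in> open_edge e" using that by auto
        have "\<psi> p \<in> points Y" using \<pi>\<psi>(2)[OF p(1)] openin_subset[OF oU] by auto
        moreover have "\<psi> p \<noteq> Vertex v" if "v \<in> verts Y" for v
          using \<pi>\<psi>(1)[OF p(1)] p(2) f[OF that] by (auto simp: open_edge_def)
        ultimately obtain e' where e': "e' \<in> edges Y" "\<psi> p \<in> open_edge e'"
          by (auto simp: points_def)
        then have "p \<in> open_edge (g e')" using g \<pi>\<psi>(1)[OF p(1)] by (metis imageI)
        then have "g e' = e" using p(2) by (auto simp: open_edge_def)
        then show ?thesis using e' by auto
      qed
    qed (use e finY in auto)
  qed
qed

section \<open>The Laplacian of a cover\<close>

text \<open>The arbitrary orientation affects only the sign, which cancels in the products below; a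
  loop has incidence 0.\<close>

definition incidence :: "('v, 'e) multigraph \<Rightarrow> 'e \<Rightarrow> 'v \<Rightarrow> int" where
  "incidence G e v = of_bool (fst (orient G e) = v) - of_bool (snd (orient G e) = v)"

text \<open>This is the product of the incidence matrix with its transpose. The edge set is a
  separate argument because the induction for the matrix-tree theorem deletes edges.\<close>

definition laplacian :: "('v, 'e) multigraph \<Rightarrow> 'e set \<Rightarrow> 'v \<Rightarrow> 'v \<Rightarrow> int" where
  "laplacian G E u v = (\<Sum>e\<in>E. incidence G e u * incidence G e v)"

lemma card_darts_singleton:
  "int (card (darts G {e} v)) = of_bool (fst (orient G e) = v) + of_bool (snd (orient G e) = v)"
proof -
  have "darts G {e} v = (if fst (orient G e) = v then {(e, True)} else {}) \<union>
      (if snd (orient G e) = v then {(e, False)} else {})"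
    by (auto simp: darts_def dart_source_def)
  then show ?thesis by auto
qed

lemma card_darts_sum:
  assumes "finite E"
  shows "card (darts G E v) = (\<Sum>e\<in>E. card (darts G {e} v))"
proof -
  have "darts G E v = (\<Union>e\<in>E. darts G {e} v)" by (auto simp: darts_def)
  also have "card \<dots> = (\<Sum>e\<in>E. card (darts G {e} v))"
    using assms by (intro card_UN_disjoint) (auto intro: finite_darts simp: darts_def)
  finally show ?thesis .
qed

text \<open>If \<open>v\<close> is not an end of \<open>e\<close> the value is unspecified; in
  \<open>laplacian_cover\<close> it is then multiplied by a number of darts that is 0.\<close>

definition opposite :: "('v, 'e) multigraph \<Rightarrow> 'e \<Rightarrow> 'v \<Rightarrow> 'v" where
  "opposite G e v = (THE u. ends G e = Upair v u)"

lemma opposite_eq: "ends G e = Upair v u \<Longrightarrow> opposite G e v = u"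
  unfolding opposite_def by (rule the_equality) auto

text \<open>Column \<open>y\<close> of the Laplacian is a sum over the darts at \<open>y\<close>,
  each contributing +1 at \<open>y\<close> and -1 at the opposite end. After pushing forward, the
  contribution depends only on the image edge, so the sum can be grouped by edges of
  \<open>X\<close> and compared through the numbers of darts.\<close>

lemma laplacian_cover:
  fixes Y :: "('w, 'f) multigraph" and X :: "('v, 'e) multigraph"
  assumes Y: "finite_multigraph Y" and X: "finite_multigraph X"
    and cov: "covering_map (realization Y) (realization X) \<pi>"
    and fV: "f \<in> verts Y \<rightarrow> verts X" and gE: "g \<in> edges Y \<rightarrow> edges X"
    and ends: "\<And>e. e \<in> edges Y \<Longrightarrow> ends X (g e) = map_uprod f (ends Y e)"
    and f: "\<And>v. v \<in> verts Y \<Longrightarrow> \<pi> (Vertex v) = Vertex (f v)"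
    and g: "\<And>e. e \<in> edges Y \<Longrightarrow> \<pi> ` open_edge e = open_edge (g e)"
    and y: "y \<in> verts Y"
  shows "(\<Sum>y'\<in>{y'\<in>verts Y. f y' = x}. laplacian Y (edges Y) y' y) = laplacian X (edges X) x (f y)"
proof -
  have mY: "multigraph Y" and finY: "finite (edges Y)" and finX: "finite (edges X)"
    and finV: "finite (verts Y)"
    using X Y by (auto simp: finite_multigraph_def)
  \<comment> \<open>\<open>q e\<close> is the contribution at \<open>x\<close> of one dart of
    \<open>e\<close> at \<open>f y\<close>. An edge of \<open>Y\<close> that is not a loop may lie
    over a loop; its contribution is then 0, as it should be.\<close>
  define q where "q e = of_bool (f y = x) - (of_bool (opposite X e (f y) = x) :: int)" for e
  have X_term: "incidence X e x * incidence X e (f y) = int (card (darts X {e} (f y))) * q e" for e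
  proof -
    have "ends X e = Upair (fst (orient X e)) (snd (orient X e))"
      "ends X e = Upair (snd (orient X e)) (fst (orient X e))"
      using ends_orient[of X e] by auto
    from this[THEN opposite_eq] show ?thesis
      by (auto simp: incidence_def card_darts_singleton q_def algebra_simps)
  qed
  have Y_term: "(\<Sum>y'\<in>{y'\<in>verts Y. f y' = x}. incidence Y e y') * incidence Y e y =
      int (card (darts Y {e} y)) * q (g e)" if e: "e \<in> edges Y" for e
  proof -
    let ?a = "fst (orient Y e)" and ?b = "snd (orient Y e)"
    have ab: "?a \<in> verts Y" "?b \<in> verts Y"
      using orient_in_verts[OF mY e] by auto
    have "(\<Sum>y'\<in>{y'\<in>verts Y. f y' = x}. incidence Y e y') = of_bool (f ?a = x) - of_bool (f ?b = x)"
      unfolding incidence_def sum_subtractf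
      using ab finV by (simp add: of_bool_def sum.delta)
    moreover have "ends X (g e) = Upair (f ?a) (f ?b)" "ends X (g e) = Upair (f ?b) (f ?a)"
      using ends[OF e] ends_orient[of Y e] by auto
    from this[THEN opposite_eq] have "opposite X (g e) (f ?a) = f ?b" "opposite X (g e) (f ?b) = f ?a" .
    ultimately show ?thesis
      by (auto simp: incidence_def card_darts_singleton q_def algebra_simps)
  qed
  have "(\<Sum>y'\<in>{y'\<in>verts Y. f y' = x}. laplacian Y (edges Y) y' y) =
      (\<Sum>e\<in>edges Y. (\<Sum>y'\<in>{y'\<in>verts Y. f y' = x}. incidence Y e y') * incidence Y e y)"
    unfolding laplacian_def by (subst sum.swap) (simp add: sum_distrib_right)
  also have "\<dots> = (\<Sum>e'\<in>edges Y. int (card (darts Y {e'} y)) * q (g e'))"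
    by (rule sum.cong) (auto simp: Y_term)
  also have "\<dots> = (\<Sum>e\<in>edges X. \<Sum>e'\<in>{e'\<in>edges Y. g e' = e}. int (card (darts Y {e'} y)) * q (g e'))"
    by (rule sum.group[symmetric, OF finY finX]) (use gE in auto)
  also have "\<dots> = (\<Sum>e\<in>edges X. int (card (darts Y {e'\<in>edges Y. g e' = e} y)) * q e)"
    using finY by (intro sum.cong refl) (simp add: card_darts_sum[of "{e' \<in> edges Y. g e' = _}"] sum_distrib_right)
  also have "\<dots> = (\<Sum>e\<in>edges X. int (card (darts X {e} (f y))) * q e)"
    by (intro sum.cong refl) (simp add: card_darts_cover[OF Y X cov fV f g y])
  also have "\<dots> = laplacian X (edges X) x (f y)"
    unfolding laplacian_def by (simp add: X_term)
  finally show ?thesis .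
qed

section \<open>Spanning trees and rooted forests\<close>

abbreviation reachable :: "('v, 'e) multigraph \<Rightarrow> 'e set \<Rightarrow> 'v \<Rightarrow> 'v \<Rightarrow> bool" where
  "reachable G T \<equiv> (adjacent (G\<lparr>edges := T\<rparr>))\<^sup>*\<^sup>*"

lemma adjacent_edges: "adjacent (G\<lparr>edges := T\<rparr>) u v \<longleftrightarrow> (\<exists>e\<in>T. ends G e = Upair u v)"
  by (simp add: adjacent_def)

lemma reachable_edge: "e \<in> T \<Longrightarrow> ends G e = Upair u v \<Longrightarrow> reachable G T u v"
  by (rule r_into_rtranclp) (auto simp: adjacent_edges)

lemma reachable_mono:
  assumes "S \<subseteq> T" "reachable G S u v"
  shows "reachable G T u v"
  by (rule rtranclp_mono[THEN predicate2D, OF _ assms(2)]) (use assms(1) in \<open>fastforce simp: adjacent_edges\<close>)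

lemma reachable_sym:
  assumes "reachable G T u v"
  shows "reachable G T v u"
proof -
  have "symp (adjacent (G\<lparr>edges := T\<rparr>))"
    by (rule sympI) (metis adjacent_edges Upair_inject)
  then show ?thesis
    using assms by (metis symp_rtranclp sympD)
qed

lemma reachable_common: "reachable G T u w \<Longrightarrow> reachable G T v w \<Longrightarrow> reachable G T u v"
  by (rule rtranclp_trans[OF _ reachable_sym])

section \<open>Edge sets that join every vertex to a root\<close>

definition reaches_roots :: "('v, 'e) multigraph \<Rightarrow> 'e set \<Rightarrow> 'v set \<Rightarrow> bool" where
  "reaches_roots G T R \<longleftrightarrow> (\<forall>v\<in>verts G. \<exists>r\<in>R. reachable G T v r)"

text \<open>A path can be stopped as soon as it is about to use \<open>e\<close>, since both ends of
  \<open>e\<close> lie in \<open>insert v R\<close>. Conversely, a path that stops at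
  \<open>v\<close> continues through \<open>e\<close> to \<open>r\<close>. This is contraction of
  \<open>e\<close> without changing the graph.\<close>

lemma reaches_roots_insert_edge:
  assumes e: "ends G e = Upair r v" and r: "r \<in> R"
  shows "reaches_roots G (insert e T) R \<longleftrightarrow> reaches_roots G T (insert v R)"
proof -
  have "(\<exists>r\<in>R. reachable G (insert e T) u r) \<longleftrightarrow> (\<exists>r\<in>insert v R. reachable G T u r)" for u
  proof
    assume "\<exists>r\<in>R. reachable G (insert e T) u r"
    then obtain r' where r': "r' \<in> R" "reachable G (insert e T) u r'" by auto
    from r'(2) show "\<exists>r\<in>insert v R. reachable G T u r"
    proof (induction rule: converse_rtranclp_induct)
      case base
      then show ?case using r' by auto
    next
      case (step u w)
      then obtain f where f: "f \<in> insert e T" "ends G f = Upair u w" by (auto simp: adjacent_edges)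
      show ?case
      proof (cases "f = e")
        case True
        then have "u \<in> insert v R" using f e r by auto
        then show ?thesis by auto
      next
        case False
        then have "reachable G T u w" using f by (intro reachable_edge[of f]) auto
        then show ?thesis using step.IH by (blast intro: rtranclp_trans)
      qed
    qed
  next
    assume "\<exists>r\<in>insert v R. reachable G T u r"
    then obtain r' where r': "r' \<in> insert v R" "reachable G (insert e T) u r'"
      using reachable_mono[OF subset_insertI[of T e], where u = u and G = G] by blast
    moreover have "reachable G (insert e T) v r"
      using reachable_edge[of e "insert e T" G v r] e by auto
    ultimately show "\<exists>r\<in>R. reachable G (insert e T) u r"
      using r by (blast intro: rtranclp_trans)
  qed
  then show ?thesis by (simp add: reaches_roots_def)
qed

text \<open>A path from a non-root to a root has to enter \<open>R\<close> along some edge.\<close>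

lemma reaches_roots_crossing_edge:
  assumes G: "multigraph G" and T: "T \<subseteq> edges G" and reach: "reaches_roots G T R"
    and "\<not> verts G \<subseteq> R"
  obtains e r v where "e \<in> T" "ends G e = Upair r v" "r \<in> R" "v \<in> verts G - R"
proof -
  obtain u where u: "u \<in> verts G" "u \<notin> R" using assms by auto
  then obtain r where r: "r \<in> R" "reachable G T u r" using reach by (auto simp: reaches_roots_def)
  from r(2) u(2) have "\<exists>e\<in>T. \<exists>r v. ends G e = Upair v r \<and> r \<in> R \<and> v \<notin> R"
  proof (induction rule: converse_rtranclp_induct)
    case base
    then show ?case using r by auto
  next
    case (step u w)
    then show ?case by (cases "w \<in> R") (auto simp: adjacent_edges)
  qed
  then obtain e r v where e: "e \<in> T" "ends G e = Upair v r" "r \<in> R" "v \<notin> R" by auto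
  moreover have "v \<in> verts G" using e G T by (force simp: multigraph_def)
  moreover have "Upair v r = Upair r v" by auto
  ultimately show ?thesis using that by auto
qed

text \<open>Select a crossing edge, make its outer end a root, and repeat: every selected edge uses
  up exactly one non-root.\<close>

lemma reaches_roots_subset:
  assumes G: "multigraph G" and fin: "finite (verts G)" and T: "T \<subseteq> edges G"
    and "reaches_roots G T R"
  obtains S where "S \<subseteq> T" "finite S" "card S = card (verts G - R)" "reaches_roots G S R"
proof -
  have "\<exists>S\<subseteq>T. finite S \<and> card S = card (verts G - R) \<and> reaches_roots G S R"
    using T assms(4)
  proof (induction "card (verts G - R)" arbitrary: T R)
    case 0
    then have "verts G \<subseteq> R" using fin by auto
    then have "reaches_roots G {} R" by (auto simp: reaches_roots_def)
    then show ?case using 0 by (intro exI[of _ "{}"]) auto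
  next
    case (Suc n)
    then have "\<not> verts G \<subseteq> R" by (metis Diff_eq_empty_iff card.empty nat.distinct(1))
    then obtain e r v where e: "e \<in> T" "ends G e = Upair r v" "r \<in> R" "v \<in> verts G - R"
      using reaches_roots_crossing_edge[OF G Suc.prems] by metis
    have Re: "verts G - insert v R = verts G - R - {v}" by auto
    have n: "n = card (verts G - insert v R)" unfolding Re using Suc.hyps(2) e fin by simp
    have "reaches_roots G (T - {e}) (insert v R)"
      using Suc.prems e by (metis insert_Diff reaches_roots_insert_edge)
    then obtain S where S: "S \<subseteq> T - {e}" "finite S" "card S = n" "reaches_roots G S (insert v R)"
      using Suc.hyps(1)[OF n, of "T - {e}"] Suc.prems n by auto
    then have "reaches_roots G (insert e S) R"
      using reaches_roots_insert_edge[OF e(2,3), of S] by blast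
    moreover have "e \<notin> S" using S(1) by auto
    then have "card (insert e S) = card (verts G - R)" using S Suc.hyps(2) by simp
    ultimately show ?case using S e by (intro exI[of _ "insert e S"]) auto
  qed
  then show ?thesis using that by blast
qed

section \<open>Cycles, and spanning trees as minimal connecting sets\<close>

text \<open>A path in \<open>S\<close> without repeated vertices from \<open>u\<close> to
  \<open>v\<close> is closed up by \<open>e\<close>. If \<open>u = v\<close> the path is empty and
  \<open>e\<close> is a cycle of length one.\<close>

lemma cycle_of_extra_edge:
  assumes G: "multigraph G" and T: "S \<subseteq> edges G" "e \<in> edges G" "e \<notin> S"
    and e: "ends G e = Upair u v" and uv: "reachable G S u v"
  shows "\<exists>vs es. is_cycle (G\<lparr>edges := insert e S\<rparr>) vs es"
proof -
  obtain xs where xs: "rtrancl_path (adjacent (G\<lparr>edges := S\<rparr>)) u xs v" "distinct (u # xs)"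
    using uv unfolding rtranclp_eq_rtrancl_path by (blast elim: rtrancl_path_distinct)
  let ?vs = "u # xs" and ?k = "length xs"
  have last: "?vs ! ?k = v"
    using rtrancl_path_last[OF xs(1)] xs(1)
    by (cases xs) (auto simp: last_conv_nth elim: rtrancl_path.cases)
  have "\<forall>i<?k. \<exists>f\<in>S. ends G f = Upair (?vs ! i) (?vs ! Suc i)"
    using rtrancl_path_nth[OF xs(1)] by (auto simp: adjacent_edges)
  then obtain f where f: "\<And>i. i < ?k \<Longrightarrow> f i \<in> S"
    "\<And>i. i < ?k \<Longrightarrow> ends G (f i) = Upair (?vs ! i) (?vs ! Suc i)" by metis
  let ?es = "map f [0..<?k] @ [e]"
  have nth_es: "?es ! i = (if i < ?k then f i else e)" if "i < Suc ?k" for i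
    using that by (auto simp: nth_append)
  have "inj_on f {0..<?k}"
  proof
    fix i j assume ij: "i \<in> {0..<?k}" "j \<in> {0..<?k}" "f i = f j"
    then have "Upair (?vs ! i) (?vs ! Suc i) = Upair (?vs ! j) (?vs ! Suc j)"
      using f(2) by (metis atLeastLessThan_iff)
    then have "?vs ! i = ?vs ! j \<or> (?vs ! i = ?vs ! Suc j \<and> ?vs ! Suc i = ?vs ! j)" by auto
    moreover have vs_eq: "?vs ! a = ?vs ! b \<longleftrightarrow> a = b" if "a \<le> ?k" "b \<le> ?k" for a b
      using nth_eq_iff_index_eq[OF xs(2)] that by simp
    ultimately have "i = j \<or> (i = Suc j \<and> Suc i = j)"
      using ij(1,2) by (simp only: vs_eq atLeastLessThan_iff Suc_leI less_imp_le)
    then show "i = j" by linarith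
  qed
  then have "distinct ?es" using f(1) T(3) by (auto simp: distinct_map)
  moreover have "ends G (?es ! i) = Upair (?vs ! i) (?vs ! (Suc i mod Suc ?k))" if "i < Suc ?k" for i
    using that f(2) last e nth_es[OF that] by (cases "i = ?k") auto
  moreover have "set ?vs \<subseteq> verts G"
  proof
    fix w assume "w \<in> set ?vs"
    then obtain i where i: "i < Suc ?k" "?vs ! i = w"
      unfolding in_set_conv_nth length_Cons by blast
    have "\<exists>f\<in>edges G. w \<in> set_uprod (ends G f)"
    proof (cases "i = ?k")
      case True
      then show ?thesis using last i e T(2) by (intro bexI[of _ e]) simp_all
    next
      case False
      then show ?thesis using f[of i] i T(1) by (intro bexI[of _ "f i"]) auto
    qed
    then show "w \<in> verts G" using G by (auto simp: multigraph_def)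
  qed
  ultimately have "is_cycle (G\<lparr>edges := insert e S\<rparr>) ?vs ?es"
    using xs(2) f(1) unfolding is_cycle_def by auto
  then show ?thesis by blast
qed

text \<open>The rest of the cycle, from \<open>vs ! 1\<close> round to \<open>vs ! 0\<close>, is a
  detour for the removed edge. For a loop the detour is empty, which the index
  \<open>Suc 0 mod ?k\<close> takes into account.\<close>

lemma reachable_remove_cycle_edge:
  assumes cyc: "is_cycle (G\<lparr>edges := T\<rparr>) vs es" and uv: "reachable G T u v"
  shows "reachable G (T - {es ! 0}) u v"
proof -
  let ?k = "length es" and ?T = "T - {es ! 0}"
  have k: "0 < ?k" and es: "\<And>i. i < ?k \<Longrightarrow> es ! i \<in> T"
    "\<And>i. i < ?k \<Longrightarrow> ends G (es ! i) = Upair (vs ! i) (vs ! (Suc i mod ?k))"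
    "\<And>i. i < ?k \<Longrightarrow> 0 < i \<Longrightarrow> es ! i \<noteq> es ! 0"
    using cyc by (auto simp: is_cycle_def nth_eq_iff_index_eq)
  have "reachable G ?T (vs ! (Suc 0 mod ?k)) (vs ! (Suc i mod ?k))" if "i < ?k" for i
    using that
  proof (induction i)
    case (Suc i)
    moreover have "reachable G ?T (vs ! Suc i) (vs ! (Suc (Suc i) mod ?k))"
      using es Suc.prems by (intro reachable_edge[of "es ! Suc i"]) auto
    ultimately show ?case by (simp add: rtranclp_trans)
  qed simp
  from this[of "?k - 1"] k have r10: "reachable G ?T (vs ! (Suc 0 mod ?k)) (vs ! 0)" by simp
  have "reachable G ?T a b" if adj: "adjacent (G\<lparr>edges := T\<rparr>) a b" for a b
  proof -
    obtain f where f: "f \<in> T" "ends G f = Upair a b" using adj unfolding adjacent_edges by blast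
    show ?thesis
    proof (cases "f = es ! 0")
      case True
      then have "Upair a b = Upair (vs ! 0) (vs ! (Suc 0 mod ?k))"
        using f es(2)[OF k] by (simp only:)
      then show ?thesis using r10 reachable_sym[OF r10] by (metis Upair_inject)
    next
      case False
      then show ?thesis using f by (intro reachable_edge) auto
    qed
  qed
  note step = this
  from uv show ?thesis
    by (induction rule: rtranclp_induct) (auto intro: rtranclp_trans dest: step)
qed

text \<open>Given that every vertex reaches \<open>R\<close>, the cardinality condition says that \<open>T\<close> is acyclic and that every
  component contains exactly one root.\<close>

definition rooted_forests :: "('v, 'e) multigraph \<Rightarrow> 'e set \<Rightarrow> 'v set \<Rightarrow> 'e set set" where
  "rooted_forests G E R = {T. T \<subseteq> E \<and> reaches_roots G T R \<and> card T = card (verts G - R)}"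

text \<open>Every connecting set contains a connecting subset of the size in question. A further
  edge would close a cycle with that subset, so an acyclic set equals it; and in a set of that size
  no edge lies on a cycle, since removing it would leave too few edges to connect.\<close>

lemma spanning_trees_eq_rooted_forests:
  assumes G: "finite_multigraph G" and x: "x \<in> verts G"
  shows "spanning_trees G = rooted_forests G (edges G) {x}"
proof -
  have mG: "multigraph G" and finV: "finite (verts G)" and finE: "finite (edges G)"
    using G by (auto simp: finite_multigraph_def)
  have connected: "connected_multigraph (G\<lparr>edges := T\<rparr>) \<longleftrightarrow> reaches_roots G T {x}" for T
  proof
    assume "connected_multigraph (G\<lparr>edges := T\<rparr>)"
    then show "reaches_roots G T {x}"
      using x by (simp add: connected_multigraph_def reaches_roots_def)
  next
    assume reach: "reaches_roots G T {x}"
    have "reachable G T u v" if "u \<in> verts G" "v \<in> verts G" for u v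
      using that reach by - (rule reachable_common[where w = x], simp_all add: reaches_roots_def)
    then have "\<forall>u\<in>verts G. \<forall>v\<in>verts G. reachable G T u v" by blast
    moreover have "verts G \<noteq> {}" using x by blast
    ultimately show "connected_multigraph (G\<lparr>edges := T\<rparr>)"
      by (simp add: connected_multigraph_def)
  qed
  have "(\<nexists>vs es. is_cycle (G\<lparr>edges := T\<rparr>) vs es) \<longleftrightarrow> card T = card (verts G - {x})"
    if T: "T \<subseteq> edges G" and reach: "reaches_roots G T {x}" for T
  proof
    assume acyclic: "\<nexists>vs es. is_cycle (G\<lparr>edges := T\<rparr>) vs es"
    obtain S where S: "S \<subseteq> T" "card S = card (verts G - {x})" "reaches_roots G S {x}"
      using reaches_roots_subset[OF mG finV T reach] by metis
    have "T \<subseteq> S"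
    proof
      fix e assume e: "e \<in> T"
      show "e \<in> S"
      proof (rule ccontr)
        assume eS: "e \<notin> S"
        obtain u v where uv: "ends G e = Upair u v" using ends_orient by metis
        then have "u \<in> verts G" "v \<in> verts G" using mG T e by (force simp: multigraph_def)+
        then have "reachable G S u v"
          using S(3) by - (rule reachable_common[where w = x], simp_all add: reaches_roots_def)
        then obtain vs es where "is_cycle (G\<lparr>edges := insert e S\<rparr>) vs es"
          using cycle_of_extra_edge[OF mG _ _ eS uv] S(1) T e by blast
        then have "is_cycle (G\<lparr>edges := T\<rparr>) vs es"
          using S(1) e by (auto simp: is_cycle_def)
        then show False using acyclic by blast
      qed
    qed
    then show "card T = card (verts G - {x})" using S by auto
  next
    assume card: "card T = card (verts G - {x})"
    show "\<nexists>vs es. is_cycle (G\<lparr>edges := T\<rparr>) vs es"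
    proof (intro notI, elim exE)
      fix vs es assume cyc: "is_cycle (G\<lparr>edges := T\<rparr>) vs es"
      then have e: "es ! 0 \<in> T" by (auto simp: is_cycle_def)
      have T': "T - {es ! 0} \<subseteq> edges G" using T by blast
      have reach': "reaches_roots G (T - {es ! 0}) {x}"
        using reach reachable_remove_cycle_edge[OF cyc] by (auto simp: reaches_roots_def)
      obtain S where S: "S \<subseteq> T - {es ! 0}" "card S = card (verts G - {x})"
        using reaches_roots_subset[OF mG finV T' reach'] by metis
      have finT: "finite T" using T finE by (rule finite_subset)
      have "card S \<le> card (T - {es ! 0})" using finT S(1) by (intro card_mono) simp_all
      moreover have "card (T - {es ! 0}) < card T" using finT e by (rule card_Diff1_less)
      ultimately show False using S card by simp
    qed
  qed
  then show ?thesis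
    unfolding spanning_trees_def rooted_forests_def is_tree_def connected by blast
qed

section \<open>Determinants\<close>

text \<open>The block matrix \<open>?M\<close> factors as \<open>?L * ?U\<close> and as
  \<open>?V * ?L\<close>, where \<open>?L\<close> has determinant 1 and the other factors have the
  two determinants to be compared. It serves to reduce a determinant of size \<open>m\<close> to one
  of size \<open>n\<close>.\<close>

lemma det_one_plus_mult_commute:
  fixes X :: "'a :: idom mat"
  assumes X: "X \<in> carrier_mat m n" and Y: "Y \<in> carrier_mat n m"
  shows "det (1\<^sub>m m + X * Y) = det (1\<^sub>m n + Y * X)"
proof -
  let ?M = "four_block_mat (1\<^sub>m n) (- Y) X (1\<^sub>m m)"
  let ?L = "four_block_mat (1\<^sub>m n) (0\<^sub>m n m) X (1\<^sub>m m)"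
  let ?U = "four_block_mat (1\<^sub>m n) (- Y) (0\<^sub>m m n) (1\<^sub>m m + X * Y)"
  let ?V = "four_block_mat (1\<^sub>m n + Y * X) (- Y) (0\<^sub>m m n) (1\<^sub>m m)"
  note c = one_carrier_mat[of n] one_carrier_mat[of m] zero_carrier_mat[of n m]
    zero_carrier_mat[of m n] X uminus_carrier_mat[OF Y]
    add_carrier_mat[OF mult_carrier_mat[OF X Y], of "1\<^sub>m m"]
    add_carrier_mat[OF mult_carrier_mat[OF Y X], of "1\<^sub>m n"]
  have XY: "X * - Y + (1\<^sub>m m + X * Y) = 1\<^sub>m m"
    using X Y by (auto intro!: eq_matI)
  have YX: "1\<^sub>m n + Y * X + - Y * X = 1\<^sub>m n"
    using X Y by (auto intro!: eq_matI)
  have LU: "?L * ?U = ?M"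
    by (subst mult_four_block_mat[OF c(1,3,5,2) c(1,6,4,7)]) (use X Y XY in auto)
  have VL: "?V * ?L = ?M"
    by (subst mult_four_block_mat[OF c(8,6,4,2) c(1,3,5,2)]) (use X Y YX in auto)
  have L: "det ?L = 1"
    using X by (simp add: det_four_block_mat_upper_right_zero[OF c(1) refl X c(2)])
  have U: "det ?U = det (1\<^sub>m m + X * Y)"
    by (simp add: det_four_block_mat_lower_left_zero[OF c(1,6) refl c(7)])
  have V: "det ?V = det (1\<^sub>m n + Y * X)"
    by (simp add: det_four_block_mat_lower_left_zero[OF c(8,6) refl c(2)])
  have "det (?L * ?U) = det ?L * det ?U" "det (?V * ?L) = det ?V * det ?L"
    using X Y by (auto intro!: det_mult[where n = "n + m"])
  then show ?thesis
    by (simp add: LU VL L U V)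
qed

lemma det_dvd_of_intertwining:
  fixes A :: "'a :: idom mat"
  assumes A: "A \<in> carrier_mat n n" and B: "B \<in> carrier_mat m m"
    and P: "P \<in> carrier_mat n m" and P': "P' \<in> carrier_mat n m" and S: "S \<in> carrier_mat m n"
    and PS: "P * S = 1\<^sub>m n" and PB: "P * B = A * P'"
  shows "det A dvd det B"
proof -
  \<comment> \<open>\<open>B = F * G\<close>, where \<open>F\<close> acts as \<open>A\<close> on the image of \<open>S\<close> and as the identity on the kernel of \<open>P\<close>.\<close>
  define K where "K = 1\<^sub>m m - S * P"
  define F where "F = 1\<^sub>m m + S * ((A - 1\<^sub>m n) * P)"
  \<comment> \<open>\<open>F\<close> replaces the summand \<open>S * P'\<close> of \<open>G\<close>
    by \<open>S * (A * P')\<close>, which is \<open>S * P * B\<close>; together with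
    \<open>K * B\<close> this makes \<open>B\<close>.\<close>
  define G where "G = S * P' + K * B"
  have K: "K \<in> carrier_mat m m" and F: "F \<in> carrier_mat m m" and G: "G \<in> carrier_mat m m"
    and AP: "(A - 1\<^sub>m n) * P \<in> carrier_mat n m" and SP: "S * P \<in> carrier_mat m m"
    and SP': "S * P' \<in> carrier_mat m m" and KB: "K * B \<in> carrier_mat m m"
    and AP': "A * P' \<in> carrier_mat n m" and SAP': "S * (A * P') \<in> carrier_mat m m"
    using A B P P' S by (auto simp: K_def F_def G_def)
  have PK: "P * K = 0\<^sub>m n m"
  proof -
    have "P * K = P * 1\<^sub>m m - P * (S * P)"
      unfolding K_def using P SP by (simp add: mult_minus_distrib_mat[OF P _ SP])
    also have "P * (S * P) = P"
      using P PS by (simp flip: assoc_mult_mat[OF P S P])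
    finally show ?thesis using P by simp
  qed
  have PG: "P * G = P'"
  proof -
    have "P * G = P * (S * P') + P * (K * B)"
      unfolding G_def by (rule mult_add_distrib_mat[OF P SP' KB])
    also have "P * (S * P') = P'"
      using P' PS by (simp flip: assoc_mult_mat[OF P S P'])
    also have "P * (K * B) = 0\<^sub>m n m"
      using B PK by (simp flip: assoc_mult_mat[OF P K B])
    finally show ?thesis using P' by simp
  qed
  have KB': "K * B = B - S * (A * P')"
  proof -
    have "K * B = 1\<^sub>m m * B - S * P * B"
      unfolding K_def by (rule minus_mult_distrib_mat[OF _ SP B]) simp
    also have "S * P * B = S * (A * P')"
      using PB by (simp add: assoc_mult_mat[OF S P B])
    finally show ?thesis using B by simp
  qed
  have "F * G = G + S * ((A - 1\<^sub>m n) * P) * G"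
    unfolding F_def using S AP G by (subst add_mult_distrib_mat[OF _ _ G, of _ m]) auto
  also have "S * ((A - 1\<^sub>m n) * P) * G = S * ((A - 1\<^sub>m n) * P')"
    using A PG by (simp add: assoc_mult_mat[OF S AP G] assoc_mult_mat[OF minus_carrier_mat[OF one_carrier_mat] P G])
  also have "(A - 1\<^sub>m n) * P' = A * P' - P'"
    using A P' by (subst minus_mult_distrib_mat[OF A _ P']) auto
  also have "S * (A * P' - P') = S * (A * P') - S * P'"
    by (rule mult_minus_distrib_mat[OF S AP' P'])
  also have "G + (S * (A * P') - S * P') = B"
  proof -
    have "X + (B - Z) + (Z - X) = B" if "X \<in> carrier_mat m m" "Z \<in> carrier_mat m m" for X Z
      using B that by (auto intro!: eq_matI)
    then show ?thesis unfolding G_def KB' using SP' SAP' .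
  qed
  finally have FG: "F * G = B" .
  then have "det B = det F * det G" using F G det_mult by metis
  moreover have "det F = det (1\<^sub>m n + ((A - 1\<^sub>m n) * P) * S)"
    unfolding F_def using S AP by (rule det_one_plus_mult_commute)
  moreover have "((A - 1\<^sub>m n) * P) * S = A - 1\<^sub>m n"
    using A P S PS by (subst assoc_mult_mat[of _ n n _ m _ n]) auto
  moreover have "1\<^sub>m n + (A - 1\<^sub>m n) = A" using A by (auto intro!: eq_matI)
  ultimately show ?thesis by simp
qed

section \<open>The matrix-tree theorem\<close>

lemma det_mat_row_add:
  fixes M :: "nat \<Rightarrow> nat \<Rightarrow> 'a :: comm_ring_1"
  assumes "k < n"
  shows "det (mat n n (\<lambda>(i, j). if i = k then a j + b j else M i j)) =
    det (mat n n (\<lambda>(i, j). if i = k then a j else M i j)) +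
    det (mat n n (\<lambda>(i, j). if i = k then b j else M i j))"
proof -
  have "mat n n (\<lambda>(i, j). if i = k then c j else M i j) =
      mat\<^sub>r n n (\<lambda>i. if i = k then vec n c else vec n (M i))" for c
    by (intro eq_matI) auto
  moreover have "vec n (\<lambda>j. a j + b j) = vec n a + vec n b" by auto
  ultimately show ?thesis
    using det_row_add[of "\<lambda>_. vec n a" k n "\<lambda>_. vec n b" "\<lambda>i. vec n (M i)"] assms by (simp cong: if_cong)
qed

text \<open>With unit rows at the roots, the determinant is the principal minor on the non-roots,
  but the size of the matrix stays fixed while roots are added.\<close>

definition rooted_laplacian :: "('v, 'e) multigraph \<Rightarrow> 'e set \<Rightarrow> 'v set \<Rightarrow> 'v \<Rightarrow> 'v \<Rightarrow> int" where
  "rooted_laplacian G E R u w = (if u \<in> R then of_bool (u = w) else laplacian G E u w)"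

lemma laplacian_insert:
  "finite E \<Longrightarrow> e \<notin> E \<Longrightarrow> laplacian G (insert e E) u w = incidence G e u * incidence G e w + laplacian G E u w"
  by (simp add: laplacian_def)

lemma incidence_mult:
  assumes "ends G e = Upair a b" "a \<noteq> b"
  shows "incidence G e u * incidence G e w =
    (of_bool (u = a) - of_bool (u = b)) * (of_bool (w = a) - of_bool (w = b))"
  using assms ends_orient[of G e] by (auto simp: incidence_def)

text \<open>Forests are divided by whether they contain \<open>e\<close>. Removing \<open>e\<close>
  from one that does gives a forest with \<open>v\<close> as an additional root: one edge fewer for
  one non-root fewer.\<close>

lemma card_rooted_forests_insert:
  assumes G: "finite_multigraph G" and E: "finite E" "e \<notin> E"
    and e: "ends G e = Upair r v" "r \<in> R" "v \<in> verts G - R"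
  shows "card (rooted_forests G (insert e E) R) =
    card (rooted_forests G E R) + card (rooted_forests G E (insert v R))"
proof -
  have finV: "finite (verts G)" using G by (simp add: finite_multigraph_def)
  have "verts G - R = insert v (verts G - insert v R)" using e by auto
  then have cardR: "card (verts G - R) = Suc (card (verts G - insert v R))"
    using finV by (metis DiffE card_insert_disjoint finite_Diff insertI1)
  have card_ins: "card (insert e T) = Suc (card T)" if "T \<subseteq> E" for T
    using that E finite_subset[of T E] by (intro card_insert_disjoint) auto
  have "rooted_forests G (insert e E) R =
      rooted_forests G E R \<union> insert e ` rooted_forests G E (insert v R)"
  proof (intro Set.set_eqI iffI)
    fix T assume T: "T \<in> rooted_forests G (insert e E) R"
    show "T \<in> rooted_forests G E R \<union> insert e ` rooted_forests G E (insert v R)"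
    proof (cases "e \<in> T")
      case False
      then show ?thesis using T by (auto simp: rooted_forests_def)
    next
      case True
      then have Te: "T = insert e (T - {e})" and TE: "T - {e} \<subseteq> E"
        using T by (auto simp: rooted_forests_def)
      have "reaches_roots G (T - {e}) (insert v R)"
        using T Te reaches_roots_insert_edge[OF e(1,2), of "T - {e}"]
        by (simp add: rooted_forests_def)
      moreover have "card (T - {e}) = card (verts G - insert v R)"
        using T card_ins[OF TE] cardR Te by (simp add: rooted_forests_def)
      ultimately have "T - {e} \<in> rooted_forests G E (insert v R)"
        using TE by (simp add: rooted_forests_def)
      then show ?thesis using Te by blast
    qed
  next
    fix T assume "T \<in> rooted_forests G E R \<union> insert e ` rooted_forests G E (insert v R)"
    then show "T \<in> rooted_forests G (insert e E) R"
    proof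
      assume "T \<in> insert e ` rooted_forests G E (insert v R)"
      then obtain S where S: "T = insert e S" "S \<subseteq> E" "reaches_roots G S (insert v R)"
        "card S = card (verts G - insert v R)"
        by (auto simp: rooted_forests_def)
      then show ?thesis
        using reaches_roots_insert_edge[OF e(1,2), of S] card_ins[OF S(2)] cardR
        by (auto simp: rooted_forests_def)
    qed (auto simp: rooted_forests_def)
  qed
  moreover have "rooted_forests G E R \<inter> insert e ` rooted_forests G E (insert v R) = {}"
    using E(2) by (auto simp: rooted_forests_def)
  moreover have fin: "finite (rooted_forests G E S)" for S
    by (rule finite_subset[of _ "Pow E"]) (use E in \<open>auto simp: rooted_forests_def\<close>)
  moreover have "inj_on (insert e) (rooted_forests G E (insert v R))"
    using E(2) by (auto simp: inj_on_def rooted_forests_def)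
  ultimately show ?thesis
    by (simp add: card_Un_disjoint card_image)
qed

text \<open>Deletion and contraction of an edge from a root \<open>r\<close> to a non-root \<open>v\<close>; contracting it amounts to
  making \<open>v\<close> a root. Without such an edge the indicator of the non-roots lies in the kernel.\<close>

lemma det_rooted_laplacian:
  assumes G: "finite_multigraph G" and vs: "bij_betw vs {0..<n} (verts G)"
    and "E \<subseteq> edges G" "R \<subseteq> verts G"
  shows "det (mat n n (\<lambda>(i, j). rooted_laplacian G E R (vs i) (vs j))) = int (card (rooted_forests G E R))"
  using assms(3,4)
proof (induction "card E" arbitrary: E R rule: less_induct)
  case less
  have mG: "multigraph G" and finV: "finite (verts G)" and finE: "finite E"
    using G less.prems finite_subset by (auto simp: finite_multigraph_def)
  have vs_inj: "vs i = vs j \<longleftrightarrow> i = j" if "i < n" "j < n" for i j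
    using vs that by (auto simp: bij_betw_def inj_on_def)
  have vs_in: "vs i \<in> verts G" if "i < n" for i
    using vs that by (auto simp: bij_betw_def)
  have vs_surj: "\<exists>k<n. vs k = u" if "u \<in> verts G" for u
  proof -
    have "u \<in> vs ` {0..<n}" using vs that by (simp add: bij_betw_imp_surj_on)
    then show ?thesis by auto
  qed
  let ?M = "mat n n (\<lambda>(i, j). rooted_laplacian G E R (vs i) (vs j))"
  show ?case
  proof (cases "\<exists>e\<in>E. \<exists>r\<in>R. \<exists>v\<in>verts G - R. ends G e = Upair r v")
    case True
    then obtain e r v where e: "e \<in> E" "r \<in> R" "v \<in> verts G" "v \<notin> R" "ends G e = Upair r v" by auto
    define E' where "E' = E - {e}"
    have E: "E = insert e E'" "e \<notin> E'" "finite E'" using e finE by (auto simp: E'_def)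
    have cE: "card E' < card E" using finE e(1) unfolding E'_def by (rule card_Diff1_less)
    obtain k l where kl: "k < n" "vs k = v" "l < n" "vs l = r"
      using vs_surj[of v] vs_surj[of r] e less.prems(2) by blast
    have "k \<noteq> l" "r \<noteq> v" using kl e by auto
    \<comment> \<open>Deleting \<open>e\<close> changes only row \<open>k\<close>, that of
      \<open>v\<close>, since the row of the root \<open>r\<close> is a unit row. So the determinant
      is studied as an additive function of row \<open>k\<close>.\<close>
    define D where "D a = det (mat n n (\<lambda>(i, j). if i = k then a j
      else rooted_laplacian G E' R (vs i) (vs j)))" for a
    have D_add: "D (\<lambda>j. a j + b j) = D a + D b" for a b
      unfolding D_def by (rule det_mat_row_add[OF kl(1)])
    let ?\<delta> = "\<lambda>u j. of_bool (u = vs j) :: int"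
    have row: "rooted_laplacian G E R (vs i) (vs j) =
        (if i = k then laplacian G E' v (vs j) + (?\<delta> v j - ?\<delta> r j)
         else rooted_laplacian G E' R (vs i) (vs j))" if "i < n" "j < n" for i j
    proof (cases "vs i \<in> R")
      case True
      then show ?thesis using kl e by (auto simp: rooted_laplacian_def)
    next
      case False
      then have "vs i \<noteq> r" using e by auto
      moreover have "vs i = v \<longleftrightarrow> i = k" using vs_inj[OF that(1) kl(1)] kl(2) by simp
      ultimately show ?thesis
        using False laplacian_insert[OF E(3,2), of G "vs i" "vs j"] \<open>r \<noteq> v\<close>
        by (auto simp: rooted_laplacian_def E(1) incidence_mult[OF e(5) \<open>r \<noteq> v\<close>])
    qed
    have "det ?M = D (\<lambda>j. laplacian G E' v (vs j) + (?\<delta> v j - ?\<delta> r j))"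
      unfolding D_def using row by (intro arg_cong[of _ _ det] eq_matI) auto
    also have "\<dots> = D (\<lambda>j. laplacian G E' v (vs j)) + D (\<lambda>j. ?\<delta> v j - ?\<delta> r j)"
      by (rule D_add)
    also have "D (\<lambda>j. laplacian G E' v (vs j)) =
        det (mat n n (\<lambda>(i, j). rooted_laplacian G E' R (vs i) (vs j)))"
      unfolding D_def using kl e
      by (intro arg_cong[of _ _ det] eq_matI) (auto simp: rooted_laplacian_def)
    also have "\<dots> = int (card (rooted_forests G E' R))"
      using less.prems E by (intro less.hyps[OF cE]) auto
    also have "D (\<lambda>j. ?\<delta> v j - ?\<delta> r j) = D (?\<delta> v)"
    proof -
      \<comment> \<open>The unit row of \<open>r\<close> already occurs as row
        \<open>l\<close>.\<close>
      have "D (?\<delta> r) = 0"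
        unfolding D_def
      proof (rule det_identical_rows[of _ n k l])
        show "row (mat n n (\<lambda>(i, j). if i = k then ?\<delta> r j else rooted_laplacian G E' R (vs i) (vs j))) k =
          row (mat n n (\<lambda>(i, j). if i = k then ?\<delta> r j else rooted_laplacian G E' R (vs i) (vs j))) l"
          using kl e \<open>k \<noteq> l\<close> by (intro eq_vecI) (auto simp: rooted_laplacian_def)
      qed (use kl \<open>k \<noteq> l\<close> in auto)
      then show ?thesis using D_add[of "\<lambda>j. ?\<delta> v j - ?\<delta> r j" "?\<delta> r"] by simp
    qed
    also have "D (?\<delta> v) = det (mat n n (\<lambda>(i, j). rooted_laplacian G E' (insert v R) (vs i) (vs j)))"
      unfolding D_def
    proof (intro arg_cong[of _ _ det] eq_matI, goal_cases)
      case (1 i j)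
      then show ?case using kl vs_inj[of i k] by (auto simp: rooted_laplacian_def)
    qed auto
    also have "\<dots> = int (card (rooted_forests G E' (insert v R)))"
      using less.prems E e by (intro less.hyps[OF cE]) auto
    finally show ?thesis
      using card_rooted_forests_insert[OF G E(3,2) e(5,2)] e by (simp add: E(1))
  next
    case no_cross: False
    show ?thesis
    proof (cases "verts G \<subseteq> R")
      case True
      then have "?M = 1\<^sub>m n"
        using vs_in vs_inj by (intro eq_matI) (auto simp: rooted_laplacian_def)
      moreover have "rooted_forests G E R = {{}}"
        using True finE finite_subset[of _ E]
        by (auto simp: rooted_forests_def reaches_roots_def Diff_eq_empty_iff[THEN iffD2])
      ultimately show ?thesis by simp
    next
      case nR: False
      have "rooted_forests G E R = {}"
      proof -
        have False if T: "T \<subseteq> E" "reaches_roots G T R" for T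
        proof -
          have "T \<subseteq> edges G" using T(1) less.prems(1) by (rule order_trans)
          then obtain e r v where "e \<in> T" "ends G e = Upair r v" "r \<in> R" "v \<in> verts G - R"
            using reaches_roots_crossing_edge[OF mG _ T(2) nR] by metis
          then show False using T(1) no_cross by blast
        qed
        then show ?thesis by (auto simp: rooted_forests_def)
      qed
      moreover have "det ?M = 0"
      proof -
        define \<eta> :: "_ \<Rightarrow> int" where "\<eta> w = of_bool (w \<notin> R)" for w
        define x :: "int vec" where "x = vec n (\<lambda>i. \<eta> (vs i))"
        obtain k where k: "k < n" "vs k \<notin> R"
          using nR vs_surj by blast
        have "x \<noteq> 0\<^sub>v n"
        proof
          assume "x = 0\<^sub>v n"
          then have "x $ k = 0" using k by simp
          then show False using k by (simp add: x_def \<eta>_def)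
        qed
        moreover have "?M *\<^sub>v x = 0\<^sub>v n"
        proof (intro eq_vecI)
          fix i assume i: "i < dim_vec (0\<^sub>v n :: int vec)"
          have inc: "(\<Sum>w\<in>verts G. incidence G e w * \<eta> w) = 0" if e: "e \<in> E" for e
          proof -
            let ?a = "fst (orient G e)" and ?b = "snd (orient G e)"
            have ab: "?a \<in> verts G" "?b \<in> verts G" using orient_in_verts[OF mG] e less.prems by auto
            have "(\<Sum>w\<in>verts G. incidence G e w * \<eta> w) = \<eta> ?a - \<eta> ?b"
              unfolding incidence_def left_diff_distrib sum_subtractf
              using ab finV by (simp add: of_bool_def if_distrib[of "\<lambda>x. x * _"] cong: if_cong)
            also have "\<eta> ?a = \<eta> ?b"
            proof -
              have "ends G e = Upair ?a ?b" "ends G e = Upair ?b ?a"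
                using ends_orient[of G e] by auto
              then have "?a \<in> R \<longleftrightarrow> ?b \<in> R"
                using no_cross e ab by blast
              then show ?thesis by (simp add: \<eta>_def)
            qed
            finally show ?thesis by simp
          qed
          have "(?M *\<^sub>v x) $ i = (\<Sum>j\<in>{0..<n}. rooted_laplacian G E R (vs i) (vs j) * \<eta> (vs j))"
            using i by (simp add: scalar_prod_def x_def)
          also have "\<dots> = (\<Sum>w\<in>verts G. rooted_laplacian G E R (vs i) w * \<eta> w)"
            by (rule sum.reindex_bij_betw[OF vs])
          also have "\<dots> = 0"
          proof (cases "vs i \<in> R")
            case True
            then show ?thesis by (auto simp: rooted_laplacian_def \<eta>_def intro!: sum.neutral)
          next
            case False
            then have "(\<Sum>w\<in>verts G. rooted_laplacian G E R (vs i) w * \<eta> w) =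
                (\<Sum>e\<in>E. incidence G e (vs i) * (\<Sum>w\<in>verts G. incidence G e w * \<eta> w))"
              by (simp add: rooted_laplacian_def laplacian_def sum_distrib_left sum_distrib_right mult.assoc)
                (rule sum.swap)
            then show ?thesis using inc by simp
          qed
          finally show "(?M *\<^sub>v x) $ i = 0\<^sub>v n $ i" using i by simp
        qed auto
        moreover have "x \<in> carrier_vec n" by (simp add: x_def)
        ultimately show ?thesis by (subst det_0_iff_vec_prod_zero[of _ n]) auto
      qed
      ultimately show ?thesis by simp
    qed
  qed
qed

text \<open>Additivity in row \<open>k\<close> gives the determinant of the Laplacian plus that with
  root \<open>vs k\<close>. The former counts forests with no root at all and vanishes.\<close>

lemma det_laplacian_add_root:
  assumes G: "finite_multigraph G" and vs: "bij_betw vs {0..<n} (verts G)" and k: "k < n"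
  shows "det (mat n n (\<lambda>(i, j). laplacian G (edges G) (vs i) (vs j) + of_bool (i = k \<and> j = k))) =
    int (\<kappa> G)"
proof -
  have vsk: "vs k \<in> verts G" using vs k by (auto simp: bij_betw_def)
  have vs_inj: "vs i = vs j \<longleftrightarrow> i = j" if "i < n" "j < n" for i j
    using vs that by (auto simp: bij_betw_def inj_on_def)
  let ?L = "\<lambda>i j. laplacian G (edges G) (vs i) (vs j)"
  have "det (mat n n (\<lambda>(i, j). ?L i j + of_bool (i = k \<and> j = k))) =
      det (mat n n (\<lambda>(i, j). if i = k then ?L k j + of_bool (k = j) else ?L i j))"
    by (intro arg_cong[of _ _ det] eq_matI) auto
  also have "\<dots> = det (mat n n (\<lambda>(i, j). if i = k then ?L k j else ?L i j)) +
      det (mat n n (\<lambda>(i, j). if i = k then of_bool (k = j) else ?L i j))"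
    by (rule det_mat_row_add[OF k])
  also have "mat n n (\<lambda>(i, j). if i = k then ?L k j else ?L i j) =
      mat n n (\<lambda>(i, j). rooted_laplacian G (edges G) {} (vs i) (vs j))"
    by (intro eq_matI) (auto simp: rooted_laplacian_def)
  also have "det \<dots> = int (card (rooted_forests G (edges G) {}))"
    using det_rooted_laplacian[OF G vs, of "edges G" "{}"] by simp
  also have "rooted_forests G (edges G) {} = {}"
    using vsk by (auto simp: rooted_forests_def reaches_roots_def)
  also have "mat n n (\<lambda>(i, j). if i = k then of_bool (k = j) else ?L i j) =
      mat n n (\<lambda>(i, j). rooted_laplacian G (edges G) {vs k} (vs i) (vs j))"
    using k vs_inj by (intro eq_matI) (auto simp: rooted_laplacian_def)
  also have "det \<dots> = int (card (rooted_forests G (edges G) {vs k}))"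
    using det_rooted_laplacian[OF G vs, of "edges G" "{vs k}"] vsk by simp
  finally show ?thesis
    by (simp add: num_spanning_trees_def spanning_trees_eq_rooted_forests[OF G vsk])
qed

section \<open>Divisibility\<close>

lemma sum_laplacian_row:
  assumes "finite_multigraph G"
  shows "(\<Sum>w\<in>verts G. laplacian G (edges G) u w) = 0"
proof -
  have G: "multigraph G" "finite (verts G)" using assms by (auto simp: finite_multigraph_def)
  have "(\<Sum>w\<in>verts G. incidence G e w) = 0" if "e \<in> edges G" for e
    using orient_in_verts[OF G(1) that] G(2) by (simp add: incidence_def sum_subtractf of_bool_def)
  then show ?thesis
    unfolding laplacian_def by (subst sum.swap) (simp flip: sum_distrib_left)
qed

lemma num_spanning_trees_dvd_of_pushforward:
  fixes X :: "('v, 'e) multigraph" and Y :: "('w, 'f) multigraph"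
  assumes X: "finite_multigraph X" and Y: "finite_multigraph Y" and ne: "verts Y \<noteq> {}"
    and f: "f ` verts Y = verts X"
    and push: "\<And>x y. y \<in> verts Y \<Longrightarrow>
      (\<Sum>y'\<in>{y'\<in>verts Y. f y' = x}. laplacian Y (edges Y) y' y) = laplacian X (edges X) x (f y)"
  shows "\<kappa> X dvd \<kappa> Y"
proof -
  define n m where "n = card (verts X)" and "m = card (verts Y)"
  obtain vX where vX: "bij_betw vX {0..<n} (verts X)"
    using X ex_bij_betw_nat_finite unfolding n_def finite_multigraph_def by blast
  obtain vY where vY: "bij_betw vY {0..<m} (verts Y)"
    using Y ex_bij_betw_nat_finite unfolding m_def finite_multigraph_def by blast
  have finY: "finite (verts Y)" using Y by (simp add: finite_multigraph_def)
  have finX: "finite (verts X)" using X by (simp add: finite_multigraph_def)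
  have l: "0 < m" unfolding m_def using ne finY by (simp add: card_gt_0_iff)
  have vY_in: "vY j \<in> verts Y" if "j < m" for j
    using vY that by (auto simp: bij_betw_def)
  have vX_in: "vX i \<in> verts X" if "i < n" for i
    using vX that by (auto simp: bij_betw_def)
  have vX_inj: "vX i = vX j \<longleftrightarrow> i = j" if "i < n" "j < n" for i j
    using vX that by (auto simp: bij_betw_def inj_on_def)
  have fvY: "f (vY j) \<in> verts X" if "j < m" for j using vY_in[OF that] f by auto
  have "f (vY 0) \<in> vX ` {0..<n}" using fvY[OF l] vX by (simp add: bij_betw_imp_surj_on)
  \<comment> \<open>Index 0 stands for y0 and \<open>k\<close> for its image, so that
    \<open>P\<close> carries the unit vector of one to that of the other.\<close>
  then obtain k where k: "k < n" "vX k = f (vY 0)" by auto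
  \<comment> \<open>One vertex is chosen in each fibre of \<open>f\<close>; the 0-1 matrix
    \<open>S\<close> of this section is the integral right inverse of \<open>P\<close>.\<close>
  define s where "s = inv_into (verts Y) f"
  have s: "s x \<in> verts Y" "f (s x) = x" if "x \<in> verts X" for x
    using that f by (simp_all add: s_def inv_into_into f_inv_into_f)
  let ?LX = "laplacian X (edges X)" and ?LY = "laplacian Y (edges Y)"
  define A where "A = mat n n (\<lambda>(i, j). ?LX (vX i) (vX j) + of_bool (i = k \<and> j = k))"
  define B where "B = mat m m (\<lambda>(i, j). ?LY (vY i) (vY j) + of_bool (i = 0 \<and> j = 0))"
  define P :: "int mat" where "P = mat n m (\<lambda>(i, j). of_bool (f (vY j) = vX i))"
  define S :: "int mat" where "S = mat m n (\<lambda>(j, i). of_bool (vY j = s (vX i)))"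
  \<comment> \<open>\<open>P\<close> itself intertwines only the Laplacians; adding multiples of the constant vector, which
    \<open>A\<close> maps to the unit vector \<open>k\<close>, corrects for the added diagonal entries.\<close>
  define c :: "nat \<Rightarrow> int" where "c j = of_bool (j = 0) - of_bool (f (vY j) = vX k)" for j
  define P' where "P' = mat n m (\<lambda>(i, j). of_bool (f (vY j) = vX i) + c j)"
  have PS: "P * S = 1\<^sub>m n"
  proof (rule eq_matI)
    fix i i' assume i: "i < dim_row (1\<^sub>m n :: int mat)" "i' < dim_col (1\<^sub>m n :: int mat)"
    have "(P * S) $$ (i, i') = (\<Sum>j\<in>{0..<m}. of_bool (f (vY j) = vX i) * of_bool (vY j = s (vX i')))"
      using i by (simp add: P_def S_def scalar_prod_def)
    also have "\<dots> = (\<Sum>y\<in>verts Y. of_bool (f y = vX i) * of_bool (y = s (vX i')))"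
      by (rule sum.reindex_bij_betw[OF vY])
    also have "\<dots> = (\<Sum>y\<in>verts Y. if y = s (vX i') then of_bool (f y = vX i) else 0)"
      by (rule sum.cong) auto
    also have "\<dots> = of_bool (f (s (vX i')) = vX i)"
      using s[OF vX_in[of i']] i finY by (simp add: sum.delta)
    finally show "(P * S) $$ (i, i') = 1\<^sub>m n $$ (i, i')"
      using s[OF vX_in[of i']] vX_inj[of i i'] i by auto
  qed (auto simp: P_def S_def)
  have PB: "P * B = A * P'"
  proof (rule eq_matI)
    fix i j assume "i < dim_row (A * P')" "j < dim_col (A * P')"
    then have ij: "i < n" "j < m" by (auto simp: A_def P'_def)
    have "(P * B) $$ (i, j) =
        (\<Sum>j'\<in>{0..<m}. of_bool (f (vY j') = vX i) * (?LY (vY j') (vY j) + of_bool (j' = 0 \<and> j = 0)))"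
      using ij by (simp add: P_def B_def scalar_prod_def)
    also have "\<dots> = (\<Sum>j'\<in>{0..<m}. of_bool (f (vY j') = vX i) * ?LY (vY j') (vY j)) +
        (\<Sum>j'\<in>{0..<m}. if j' = 0 then of_bool (f (vY j') = vX i) * of_bool (j = 0) else 0)"
      unfolding sum.distrib[symmetric] by (rule sum.cong) (auto simp: distrib_left)
    also have "(\<Sum>j'\<in>{0..<m}. of_bool (f (vY j') = vX i) * ?LY (vY j') (vY j)) =
        (\<Sum>y\<in>verts Y. of_bool (f y = vX i) * ?LY y (vY j))"
      by (rule sum.reindex_bij_betw[OF vY])
    also have "\<dots> = (\<Sum>y'\<in>{y'\<in>verts Y. f y' = vX i}. ?LY y' (vY j))"
      using finY by (simp add: sum.inter_filter of_bool_def if_distrib[of "\<lambda>x. x * _"] cong: if_cong)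
    also have "\<dots> = ?LX (vX i) (f (vY j))"
      by (rule push[OF vY_in[OF ij(2)]])
    also have "(\<Sum>j'\<in>{0..<m}. if j' = 0 then of_bool (f (vY j') = vX i) * of_bool (j = 0) else 0) =
        (of_bool (i = k) * of_bool (j = 0) :: int)"
      using l k vX_inj[OF ij(1) k(1)] by (simp add: sum.delta eq_commute[of "f (vY 0)"])
    finally have lhs: "(P * B) $$ (i, j) = ?LX (vX i) (f (vY j)) + of_bool (i = k) * of_bool (j = 0)" .
    have "(A * P') $$ (i, j) = (\<Sum>i'\<in>{0..<n}. (?LX (vX i) (vX i') + of_bool (i = k \<and> i' = k)) *
        (of_bool (f (vY j) = vX i') + c j))"
      using ij by (simp add: A_def P'_def scalar_prod_def)
    also have "\<dots> = (\<Sum>i'\<in>{0..<n}. (?LX (vX i) (vX i') * of_bool (f (vY j) = vX i') + c j * ?LX (vX i) (vX i')) +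
        (if i' = k then of_bool (i = k) * (of_bool (f (vY j) = vX i') + c j) else 0))"
      by (rule sum.cong) (auto simp: algebra_simps)
    also have "\<dots> = (\<Sum>i'\<in>{0..<n}. ?LX (vX i) (vX i') * of_bool (f (vY j) = vX i') + c j * ?LX (vX i) (vX i')) +
        of_bool (i = k) * (of_bool (f (vY j) = vX k) + c j)"
      using k(1) by (simp add: sum.distrib sum.delta)
    also have "(\<Sum>i'\<in>{0..<n}. ?LX (vX i) (vX i') * of_bool (f (vY j) = vX i') + c j * ?LX (vX i) (vX i')) =
        (\<Sum>x\<in>verts X. ?LX (vX i) x * of_bool (f (vY j) = x) + c j * ?LX (vX i) x)"
      by (rule sum.reindex_bij_betw[OF vX])
    also have "\<dots> = (\<Sum>x\<in>verts X. if f (vY j) = x then ?LX (vX i) x else 0) + c j * (\<Sum>x\<in>verts X. ?LX (vX i) x)"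
      unfolding sum.distrib sum_distrib_left by (intro arg_cong2[of _ _ _ _ "(+)"] sum.cong) auto
    also have "\<dots> = ?LX (vX i) (f (vY j))"
      using fvY[OF ij(2)] finX by (simp add: sum_laplacian_row[OF X] sum.delta)
    finally have rhs: "(A * P') $$ (i, j) =
        ?LX (vX i) (f (vY j)) + of_bool (i = k) * (of_bool (f (vY j) = vX k) + c j)" .
    show "(P * B) $$ (i, j) = (A * P') $$ (i, j)"
      unfolding lhs rhs c_def by simp
  qed (auto simp: A_def B_def P_def P'_def)
  have "det A dvd det B"
    by (rule det_dvd_of_intertwining[OF _ _ _ _ _ PS PB])
      (auto simp: A_def B_def P_def P'_def S_def)
  then have "int (\<kappa> X) dvd int (\<kappa> Y)"
    unfolding A_def B_def
    by (simp only: det_laplacian_add_root[OF X vX k(1)] det_laplacian_add_root[OF Y vY l])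
  then show ?thesis by simp
qed

theorem corollary4p10:
  fixes X :: "('v, 'e) multigraph"
    and Y :: "('w, 'f) multigraph"
    and \<pi> :: "('w, 'f) point \<Rightarrow> ('v, 'e) point"
  assumes "finite_multigraph X" and "connected_multigraph X"
    and "\<forall>v\<in>verts X. vertex_degree X v \<noteq> 1"
    and "finite_multigraph Y" and "connected_multigraph Y"
    and "\<forall>w\<in>verts Y. vertex_degree Y w \<noteq> 1"
    and "abelian_cover Y X \<pi>"
  shows "\<kappa> X dvd \<kappa> Y"
proof -
  have mX: "multigraph X" and mY: "multigraph Y"
    using assms(1,4) by (auto simp: finite_multigraph_def)
  have cov: "covering_map (realization Y) (realization X) \<pi>" and mor: "is_morphism Y X \<pi>"
    using assms(7) by (auto simp: abelian_cover_def galois_cover_def is_cover_def)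
  from mor[unfolded is_morphism_def, THEN conjunct2] obtain f g
    where fV: "f \<in> verts Y \<rightarrow> verts X" and gE: "g \<in> edges Y \<rightarrow> edges X"
      and ends: "\<forall>e\<in>edges Y. ends X (g e) = map_uprod f (ends Y e)"
      and f: "\<forall>v\<in>verts Y. \<pi> (Vertex v) = Vertex (f v)"
      and g: "\<forall>e\<in>edges Y. \<pi> ` open_edge e = open_edge (g e)"
    by iprover
  show ?thesis
  proof (rule num_spanning_trees_dvd_of_pushforward[OF assms(1,4)])
    show "verts Y \<noteq> {}" using assms(5) by (simp add: connected_multigraph_def)
    show "f ` verts Y = verts X"
    proof
      show "f ` verts Y \<subseteq> verts X" using fV by auto
      show "verts X \<subseteq> f ` verts Y"
      proof
        fix x assume x: "x \<in> verts X"
        obtain y where "y \<in> verts Y" "f y = x"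
          by (rule cover_surj_on_verts[OF mY mX cov f[rule_format] g[rule_format] x])
        then show "x \<in> f ` verts Y" by blast
      qed
    qed
  qed (rule laplacian_cover[OF assms(4,1) cov fV gE ends[rule_format] f[rule_format] g[rule_format]])
qed

end
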